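(* Let $1\le N\le L-1$. The set of Schur polynomials $\{s_\lambda: L-N\ge\lambda_1\ge\cdots\ge\lambda_N\ge0\}$ in $N$ variables, restricted to the set $\mathbb U_L$ of $L$-th roots of unity, i.e. the functions $$\eta=\{\eta_1,\dots,\eta_N\}\in\mathcal C_{L,N}\longmapsto s_\lambda\left(e^{2i\pi\eta_1/L},\dots,e^{2i\pi\eta_N/L}\right),$$ forms an orthonormal basis of $\ell^2(\mathcal C_{L,N},\psi^2\,dm)$ consisting of eigenfunctions of the MESSEP kernel $P$.
   Context: $\mathcal C_{L,N}$ is the set of $N$-element subsets of $\{0,\dots,L-1\}\simeq\mathbb Z/L\mathbb Z$, made into an undirected connected graph by joining two configurations when one is obtained from the other by moving exactly one particle to a nearest-neighbour ($\pm1$ mod $L$) empty site. Let $A$ be its adjacency matrix, $\rho$ its spectral radius, and $\psi>0$ the positive eigenvector, $A\psi=\rho\psi$, normalized by $\sum_{\eta}\psi(\eta)^2=1$. The MESSEP kernel is $P(\xi,\eta)=A(\xi,\eta)\psi(\eta)/(\rho\psi(\xi))$, and $m$ is the counting measure on $\mathcal C_{L,N}$. For an integer partition $\lambda=(\lambda_1\ge\cdots\ge\lambda_N\ge0)$, the Schur polynomial is $s_\lambda(X_1,\dots,X_N)=\det(X_j^{\lambda_i+N-i})_{1\le i,j\le N}/\det(X_j^{N-i})_{1\le i,j\le N}$. *)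

theory Defs
  imports
    Complex_Main
    "HOL-Library.Countable_Set"
    "Jordan_Normal_Form.Determinant"
    "Jordan_Normal_Form.Spectral_Radius"
begin

definition configs :: "nat \<Rightarrow> nat \<Rightarrow> nat set set" where
  "configs L N = {\<eta>. \<eta> \<subseteq> {..<L} \<and> card \<eta> = N}"

text \<open>Symmetric on subsets of \<open>{..<L}\<close>: moving the particle back undoes the jump.\<close>

definition adjacent :: "nat \<Rightarrow> nat set \<Rightarrow> nat set \<Rightarrow> bool" where
  "adjacent L \<xi> \<eta> \<longleftrightarrow>
     (\<exists>x\<in>\<xi>. \<exists>y<L. y \<notin> \<xi> \<and> (y = (x + 1) mod L \<or> x = (y + 1) mod L)
        \<and> \<eta> = insert y (\<xi> - {x}))"

definition adj :: "nat \<Rightarrow> nat set \<Rightarrow> nat set \<Rightarrow> real" where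
  "adj L \<xi> \<eta> = (if adjacent L \<xi> \<eta> then 1 else 0)"

text \<open>The matrix library indexes by initial segments of the naturals, so the adjacency
  matrix is transported along the enumeration \<open>from_nat_into\<close> of the finite set
  \<open>configs L N\<close>; the spectral radius does not depend on that enumeration.\<close>

definition adj_mat :: "nat \<Rightarrow> nat \<Rightarrow> complex mat" where
  "adj_mat L N = mat (card (configs L N)) (card (configs L N))
     (\<lambda>(i, j). complex_of_real
        (adj L (from_nat_into (configs L N) i) (from_nat_into (configs L N) j)))"

definition adj_radius :: "nat \<Rightarrow> nat \<Rightarrow> real" where
  "adj_radius L N = spectral_radius (adj_mat L N)"

definition messep_kernel :: "nat \<Rightarrow> nat \<Rightarrow> (nat set \<Rightarrow> real) \<Rightarrow> nat set \<Rightarrow> nat set \<Rightarrow> real" where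
  "messep_kernel L N \<psi> \<xi> \<eta> = adj L \<xi> \<eta> * \<psi> \<eta> / (adj_radius L N * \<psi> \<xi>)"

text \<open>Partitions are lists, indexed from 0: \<open>lam ! i\<close> is \<open>\<lambda>\<^sub>i\<^sub>+\<^sub>1\<close>, which turns the exponent
  \<open>\<lambda>\<^sub>i + N - i\<close> into \<open>lam ! i + (N - 1 - i)\<close>.\<close>

definition partitions_in_box :: "nat \<Rightarrow> nat \<Rightarrow> nat list set" where
  "partitions_in_box N M =
     {lam. length lam = N \<and> sorted_wrt (\<ge>) lam \<and> (\<forall>k\<in>set lam. k \<le> M)}"

text \<open>Value of the Schur polynomial at a point with pairwise distinct coordinates, where the
  denominator (a Vandermonde determinant) does not vanish. At other points the quotient is 0
  by the convention on division and is not the value of the polynomial.\<close>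

definition schur :: "nat \<Rightarrow> nat list \<Rightarrow> (nat \<Rightarrow> 'a :: field) \<Rightarrow> 'a" where
  "schur N lam X =
     det (mat N N (\<lambda>(i, j). X j ^ (lam ! i + (N - 1 - i)))) /
     det (mat N N (\<lambda>(i, j). X j ^ (N - 1 - i)))"

text \<open>The particles of \<open>\<eta>\<close> are listed increasingly; as \<open>schur\<close> is symmetric in its
  arguments, any other enumeration of \<open>\<eta>\<close> gives the same value.\<close>

definition schur_config :: "nat \<Rightarrow> nat \<Rightarrow> nat list \<Rightarrow> nat set \<Rightarrow> complex" where
  "schur_config L N lam \<eta> =
     schur N lam
       (\<lambda>j. exp (2 * \<i> * complex_of_real pi * of_nat (sorted_list_of_set \<eta> ! j) / of_nat L))"

text \<open>Complex \<open>\<ell>\<^sup>2(S, w dm)\<close> for a finite set \<open>S\<close> with counting measure \<open>m\<close>. Elements are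
  represented by functions on the ambient type, of which only the values on \<open>S\<close> matter;
  finiteness of \<open>S\<close> makes every function square summable.\<close>

definition l2_inner :: "'a set \<Rightarrow> ('a \<Rightarrow> real) \<Rightarrow> ('a \<Rightarrow> complex) \<Rightarrow> ('a \<Rightarrow> complex) \<Rightarrow> complex" where
  "l2_inner S w f g = (\<Sum>x\<in>S. f x * cnj (g x) * complex_of_real (w x))"

definition l2_orthonormal_basis ::
  "'a set \<Rightarrow> ('a \<Rightarrow> real) \<Rightarrow> 'i set \<Rightarrow> ('i \<Rightarrow> 'a \<Rightarrow> complex) \<Rightarrow> bool" where
  "l2_orthonormal_basis S w I e \<longleftrightarrow>
     finite S \<and> finite I \<and>
     (\<forall>i\<in>I. \<forall>j\<in>I. l2_inner S w (e i) (e j) = (if i = j then 1 else 0)) \<and>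
     (\<forall>f. \<exists>c. \<forall>x\<in>S. f x = (\<Sum>i\<in>I. c i * e i x))"

definition eigenfunction_on :: "'a set \<Rightarrow> ('a \<Rightarrow> 'a \<Rightarrow> real) \<Rightarrow> ('a \<Rightarrow> complex) \<Rightarrow> bool" where
  "eigenfunction_on S K f \<longleftrightarrow>
     (\<exists>x\<in>S. f x \<noteq> 0) \<and>
     (\<exists>\<kappa>. \<forall>x\<in>S. (\<Sum>y\<in>S. complex_of_real (K x y) * f y) = \<kappa> * f x)"

end

theory Submission
  imports Defs
begin

text \<open>
  Particles on a ring that exclude one another behave like free fermions. For functions
  \<open>f\<^sub>1, \<dots>, f\<^sub>N\<close> of a single position the determinant of the matrix \<open>f\<^sub>i (x\<^sub>j)\<close> is antisymmetric in the
  positions, so it vanishes when two of them coincide. Summing it over all unit moves of one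
  particle therefore automatically ignores the moves onto occupied sites. For plane waves
  \<open>f\<^sub>i x = cis (\<theta>\<^sub>i * x)\<close> the sum over all unit moves is the multiplication by \<open>\<Sum>i. 2 * cos \<theta>\<^sub>i\<close>
  (\<open>slater_plane_waves_laplacian\<close>).

  Moving a particle across the end of \<open>{0..<L}\<close> permutes the ordered positions cyclically, which
  costs the sign \<open>(-1) ^ (N - 1)\<close>. The momenta must compensate it, which shifts them by
  \<open>- (N - 1) * pi / L\<close> from the multiples of \<open>2 * pi / L\<close>. For
  \<open>\<theta>\<^sub>i = pi * (2 * k\<^sub>i - (N - 1)) / L\<close>, with \<open>k\<^sub>i\<close> the exponents in the numerator of the Schur
  function \<open>s\<close>, the determinant is a constant times \<open>\<bar>V\<bar> * s\<close>, where \<open>V\<close> is the Vandermonde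
  determinant of the roots of unity. Indeed \<open>V\<close> is, up to exactly the phases that the shift
  introduces, the product of \<open>2 * sin (pi * (x\<^sub>l - x\<^sub>j) / L)\<close> over \<open>j < l\<close>, and these sines are
  nonnegative as long as the ordered positions span at most one period
  (\<open>plane_waves_eq_weighted_schur\<close>). Since \<open>\<bar>V\<bar> * s\<close> depends on the configuration alone, the
  sign at the end of the interval never has to be followed, and \<open>\<bar>V\<bar> * s\<close> is an eigenfunction of
  the adjacency matrix (\<open>weighted_schur_adj_eigen\<close>).

  For the empty partition \<open>s = 1\<close>, so \<open>\<bar>V\<bar>\<close> is a positive eigenvector. The graph is connected,
  hence positive eigenvectors are proportional and \<open>\<psi> = t * \<bar>V\<bar>\<close> for a constant \<open>t\<close>
  (\<open>ground_state\<close>). Conjugation by \<open>\<psi>\<close> turns the adjacency matrix into a multiple of the kernel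
  and \<open>\<bar>V\<bar> * s\<close> into a multiple of \<open>s\<close>, so \<open>s\<close> is an eigenfunction of the kernel.

  With the weight \<open>\<psi>\<^sup>2 = t\<^sup>2 * \<bar>V\<bar>\<^sup>2\<close> the inner product of two Schur functions is a sum of products
  of two determinants. Andreief's identity (\<open>sum_configs_slater_mult_slater\<close>) reduces it to the
  orthogonality of the characters of \<open>\<int> / L\<int>\<close> (\<open>schur_config_orthogonal\<close>). Finally, the exponents
  match the partitions in the box with the configurations (\<open>bij_betw_partitions_configs\<close>), so the
  orthonormal family has as many members as the space has dimensions.
\<close>

section \<open>Determinants of one-particle functions\<close>

text \<open>
  The Slater determinant of quantum mechanics, the antisymmetrised product of \<open>N\<close> functions of
  one particle. The numerator and the denominator of a Schur polynomial both have this form.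
\<close>

definition slater :: "nat \<Rightarrow> (nat \<Rightarrow> 'b \<Rightarrow> 'a :: comm_ring_1) \<Rightarrow> (nat \<Rightarrow> 'b) \<Rightarrow> 'a" where
  "slater N f x = det (mat N N (\<lambda>(i, j). f i (x j)))"

lemma slater_cong:
  assumes "\<And>i j. i < N \<Longrightarrow> j < N \<Longrightarrow> f i (x j) = g i (y j)"
  shows "slater N f x = slater N g y"
proof -
  have "mat N N (\<lambda>(i, j). f i (x j)) = mat N N (\<lambda>(i, j). g i (y j))"
    by (rule eq_matI) (auto simp: assms)
  then show ?thesis by (simp add: slater_def)
qed

text \<open>
  Expanding by columns leaves the points in place and permutes the functions, so that a change
  of \<open>x j\<close> affects a single factor of each summand.
\<close>

lemma slater_leibniz:
  "slater N f x = (\<Sum>p | p permutes {0..<N}. signof p * (\<Prod>j<N. f (p j) (x j)))"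
proof -
  have "slater N f x = (\<Sum>p | p permutes {0..<N}. signof p *
          (\<Prod>j<N. mat N N (\<lambda>(i, j). f i (x j)) $$ (p j, j)))"
    unfolding slater_def by (rule det_col[where n = N]) simp
  also have "\<dots> = (\<Sum>p | p permutes {0..<N}. signof p * (\<Prod>j<N. f (p j) (x j)))"
  proof (rule sum.cong[OF refl])
    fix p assume p: "p \<in> {p. p permutes {0..<N}}"
    have "p j < N" if "j < N" for j
      using permutes_in_image[of p "{0..<N}" j] p that by auto
    then show "signof p * (\<Prod>j<N. mat N N (\<lambda>(i, j). f i (x j)) $$ (p j, j))
        = signof p * (\<Prod>j<N. f (p j) (x j))"
      by (intro arg_cong2[where f = "(*)"] refl prod.cong) auto
  qed
  finally show ?thesis .
qed

lemma slater_leibniz_rows: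
  "slater N f x = (\<Sum>p | p permutes {0..<N}. signof p * (\<Prod>i<N. f i (x (p i))))"
proof -
  have "slater N f x = (\<Sum>p | p permutes {0..<N}. signof p *
          (\<Prod>i = 0..<N. mat N N (\<lambda>(i, j). f i (x j)) $$ (i, p i)))"
    unfolding slater_def by (rule det_def') simp
  also have "\<dots> = (\<Sum>p | p permutes {0..<N}. signof p * (\<Prod>i<N. f i (x (p i))))"
  proof (rule sum.cong[OF refl])
    fix p assume p: "p \<in> {p. p permutes {0..<N}}"
    have "p j < N" if "j < N" for j
      using permutes_in_image[of p "{0..<N}" j] p that by auto
    then show "signof p * (\<Prod>i = 0..<N. mat N N (\<lambda>(i, j). f i (x j)) $$ (i, p i))
        = signof p * (\<Prod>i<N. f i (x (p i)))"
      by (intro arg_cong2[where f = "(*)"] refl prod.cong) auto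
  qed
  finally show ?thesis .
qed

lemma slater_permute:
  assumes p: "p permutes {0..<N}"
  shows "slater N f (x \<circ> p) = signof p * slater N f x"
proof -
  let ?A = "mat N N (\<lambda>(i, j). f i (x j))"
  have pN: "p j < N" if "j < N" for j
    using permutes_in_image[OF p, of j] that by auto
  have "slater N f (x \<circ> p) = det (mat N N (\<lambda>(i, j). f i ((x \<circ> p) j)))"
    by (simp add: slater_def)
  also have "\<dots> = det (transpose_mat (mat N N (\<lambda>(i, j). f i ((x \<circ> p) j))))"
    by (rule det_transpose[symmetric, where n = N]) simp
  also have "transpose_mat (mat N N (\<lambda>(i, j). f i ((x \<circ> p) j)))
      = mat N N (\<lambda>(i, j). transpose_mat ?A $$ (p i, j))"
    by (rule eq_matI) (auto simp: pN)
  also have "det \<dots> = signof p * det (transpose_mat ?A)"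
    by (rule det_permute_rows) (auto simp: p)
  also have "det (transpose_mat ?A) = slater N f x"
    unfolding slater_def by (rule det_transpose[where n = N]) simp
  finally show ?thesis .
qed

lemma slater_repeated_point:
  assumes "a < N" "b < N" "a \<noteq> b" and "\<And>i. i < N \<Longrightarrow> f i (x a) = f i (x b)"
  shows "slater N f x = 0"
  unfolding slater_def
  by (rule det_identical_columns[where n = N and i = a and j = b])
     (use assms in \<open>auto intro!: eq_vecI\<close>)

lemma slater_mult_columns:
  "slater N (\<lambda>i t. c t * f i t) x = (\<Prod>j<N. c (x j)) * slater N f x"
  by (simp add: slater_leibniz prod.distrib sum_distrib_left algebra_simps)

section \<open>The Vandermonde determinant\<close>

text \<open>
  As a polynomial in its last point, the determinant has degree at most \<open>N\<close> and vanishes at the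
  \<open>N\<close> other points. It is therefore a multiple of the product of the linear factors, and Laplace
  expansion along the last column shows that the multiple, its leading coefficient, is the
  determinant of one size less, up to a sign that the order of the differences absorbs.
\<close>

lemma slater_powers_step:
  fixes X :: "nat \<Rightarrow> 'a :: field"
  assumes inj: "inj_on X {..<N}"
  shows "slater (Suc N) (\<lambda>i t. t ^ (N - i)) X =
     slater N (\<lambda>i t. t ^ (N - 1 - i)) X * (\<Prod>j<N. X j - X N)"
proof -
  let ?V = "\<lambda>n. slater n (\<lambda>i t. t ^ (n - 1 - i))"
  define C where "C i = cofactor (mat (Suc N) (Suc N) (\<lambda>(i, j). X j ^ (N - i))) i N" for i
  \<comment> \<open>the determinant as a polynomial in its last point\<close>
  define P where "P = (\<Sum>i<Suc N. monom (C i) (N - i))"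
  have expand: "slater (Suc N) (\<lambda>i t. t ^ (N - i)) (X(N := t)) = poly P t" for t
  proof -
    let ?A = "mat (Suc N) (Suc N) (\<lambda>(i, j). (X(N := t)) j ^ (N - i))"
    have C': "cofactor ?A i N = C i" if "i < Suc N" for i
    proof -
      have "mat_delete ?A i N = mat_delete (mat (Suc N) (Suc N) (\<lambda>(i, j). X j ^ (N - i))) i N"
        by (rule eq_matI) (use that in \<open>auto simp: mat_delete_def\<close>)
      then show ?thesis by (simp add: C_def cofactor_def)
    qed
    have "slater (Suc N) (\<lambda>i t. t ^ (N - i)) (X(N := t)) = det ?A"
      by (simp add: slater_def)
    also have "\<dots> = (\<Sum>i<Suc N. ?A $$ (i, N) * cofactor ?A i N)"
      by (rule laplace_expansion_column) auto
    also have "\<dots> = (\<Sum>i<Suc N. C i * t ^ (N - i))"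
      by (rule sum.cong) (auto simp: C' fun_upd_same simp del: fun_upd_apply)
    also have "\<dots> = poly P t"
      by (simp add: P_def poly_sum poly_monom)
    finally show ?thesis .
  qed
  have C0: "C 0 = (- 1) ^ N * ?V N X"
  proof -
    have "mat_delete (mat (Suc N) (Suc N) (\<lambda>(i, j). X j ^ (N - i))) 0 N
        = mat N N (\<lambda>(i, j). X j ^ (N - 1 - i))"
      by (rule eq_matI) (auto simp: mat_delete_def)
    then show ?thesis by (simp add: C_def cofactor_def slater_def)
  qed
  \<comment> \<open>the leading terms cancel, so a nonzero \<open>Q\<close> would have degree below \<open>N\<close> and \<open>N\<close> roots\<close>
  define Q where "Q = P - [:C 0:] * (\<Prod>j<N. [:- X j, 1:])"
  have rootsP: "poly P (X j) = 0" if "j < N" for j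
  proof -
    have "slater (Suc N) (\<lambda>i t. t ^ (N - i)) (X(N := X j)) = 0"
      by (rule slater_repeated_point[where a = j and b = N]) (use that in auto)
    then show ?thesis using expand by simp
  qed
  have degprod: "degree (\<Prod>j<N. [:- X j, 1:]) = N"
    by (subst degree_prod_eq_sum_degree) auto
  have lead: "coeff (\<Prod>j<N. [:- X j, 1:]) N = 1"
    using lead_coeff_prod[of "\<lambda>j. [:- X j, 1:]" "{..<N}"] degprod by simp
  have Q0: "Q = 0"
  proof (rule ccontr)
    assume nz: "Q \<noteq> 0"
    have cP: "coeff P n = (if n \<le> N then C (N - n) else 0)" for n
    proof -
      have "coeff P n = (\<Sum>i<Suc N. if i = N - n \<and> n \<le> N then C i else 0)"
        unfolding P_def coeff_sum coeff_monom by (rule sum.cong) auto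
      also have "\<dots> = (if n \<le> N then C (N - n) else 0)"
        by (cases "n \<le> N") (auto simp: sum.delta)
      finally show ?thesis .
    qed
    have "coeff Q n = 0" if "n \<ge> N" for n
    proof (cases "n = N")
      case True
      then show ?thesis using cP[of N] lead by (simp add: Q_def)
    next
      case False
      then show ?thesis using cP[of n] that degprod
        by (simp add: Q_def coeff_eq_0)
    qed
    then have "degree Q < N"
      using nz by (metis leading_coeff_0_iff not_le)
    moreover have "X ` {..<N} \<subseteq> {t. poly Q t = 0}"
      by (auto simp: Q_def rootsP poly_prod)
    then have "card (X ` {..<N}) \<le> degree Q"
      using card_mono[OF poly_roots_finite[OF nz]] card_poly_roots_bound[OF nz] le_trans by blast
    moreover have "card (X ` {..<N}) = N" using inj by (simp add: card_image)
    ultimately show False by simp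
  qed
  have "slater (Suc N) (\<lambda>i t. t ^ (N - i)) X = poly P (X N)"
    using expand[of "X N"] by simp
  also have "\<dots> = C 0 * (\<Prod>j<N. X N - X j)"
    using Q0 by (simp add: Q_def poly_prod)
  also have "(\<Prod>j<N. X N - X j) = (\<Prod>j<N. - (X j - X N))"
    by simp
  also have "\<dots> = (- 1) ^ N * (\<Prod>j<N. X j - X N)"
    by (simp only: prod_uminus card_lessThan)
  also have "C 0 * ((- 1) ^ N * (\<Prod>j<N. X j - X N))
      = ((- 1) ^ N * (- 1) ^ N) * (?V N X * (\<Prod>j<N. X j - X N))"
    unfolding C0 by (simp only: ac_simps)
  finally show ?thesis
    by (simp only: minus_one_mult_self mult_1_left)
qed

lemma slater_powers_eq_prod:
  fixes X :: "nat \<Rightarrow> 'a :: field"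
  shows "slater N (\<lambda>i t. t ^ (N - 1 - i)) X = (\<Prod>l<N. \<Prod>j<l. X j - X l)"
proof (induction N)
  case 0
  then show ?case by (simp add: slater_def)
next
  case (Suc N)
  show ?case
  proof (cases "inj_on X {..<N}")
    case True
    then show ?thesis using Suc slater_powers_step[OF True] by simp
  next
    case False
    then obtain a b where ab: "a < N" "b < N" "a \<noteq> b" "X a = X b"
      by (auto simp: inj_on_def)
    have "slater (Suc N) (\<lambda>i t. t ^ (Suc N - 1 - i)) X = 0"
      by (rule slater_repeated_point[where a = a and b = b]) (use ab in auto)
    moreover have "slater N (\<lambda>i t. t ^ (N - 1 - i)) X = 0"
      by (rule slater_repeated_point[where a = a and b = b]) (use ab in auto)
    ultimately show ?thesis using Suc by simp
  qed
qed

definition vandermonde :: "nat \<Rightarrow> (nat \<Rightarrow> 'a :: field) \<Rightarrow> 'a" where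
  "vandermonde N X = slater N (\<lambda>i t. t ^ (N - 1 - i)) X"

lemma vandermonde_eq_prod: "vandermonde N X = (\<Prod>l<N. \<Prod>j<l. X j - X l)"
  unfolding vandermonde_def by (rule slater_powers_eq_prod)

lemma vandermonde_eq_0_iff: "vandermonde N X = 0 \<longleftrightarrow> \<not> inj_on X {..<N}"
proof
  assume "vandermonde N X = 0"
  then obtain j l where "j < l" "l < N" "X j = X l"
    by (auto simp: vandermonde_eq_prod)
  then show "\<not> inj_on X {..<N}" by (auto simp: inj_on_def)
next
  assume "\<not> inj_on X {..<N}"
  then obtain a b where "a < N" "b < N" "a \<noteq> b" "X a = X b" by (auto simp: inj_on_def)
  then show "vandermonde N X = 0"
    unfolding vandermonde_def by (intro slater_repeated_point[of a N b]) auto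
qed

section \<open>Free motion of plane waves\<close>

text \<open>
  Moving the point \<open>x j\<close> by \<open>s\<close> multiplies the summand of \<open>p\<close> in the Leibniz expansion by
  \<open>cis (\<theta> (p j) * s)\<close>. Adding \<open>s = 1\<close> and \<open>s = -1\<close> and summing over \<open>j\<close> gives the factor
  \<open>\<Sum>j. 2 * cos (\<theta> (p j))\<close>, and this is the same for every permutation \<open>p\<close>.
\<close>

lemma slater_plane_waves_laplacian:
  fixes N :: nat and \<theta> :: "nat \<Rightarrow> real" and x :: "nat \<Rightarrow> real"
  defines "D \<equiv> slater N (\<lambda>i t. cis (\<theta> i * t))"
  shows "(\<Sum>j<N. D (x(j := x j + 1)) + D (x(j := x j - 1)))
       = complex_of_real (\<Sum>i<N. 2 * cos (\<theta> i)) * D x"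
proof -
  have shift: "D (x(j := x j + s))
      = (\<Sum>p | p permutes {0..<N}. cis (\<theta> (p j) * s) * (signof p * (\<Prod>l<N. cis (\<theta> (p l) * x l))))"
    if j: "j < N" for j s
  proof -
    have "(\<Prod>l<N. cis (\<theta> (p l) * (x(j := x j + s)) l))
        = cis (\<theta> (p j) * s) * (\<Prod>l<N. cis (\<theta> (p l) * x l))" for p
    proof -
      have "(\<Prod>l<N. cis (\<theta> (p l) * (x(j := x j + s)) l))
          = (\<Prod>l<N. (if l = j then cis (\<theta> (p j) * s) else 1) * cis (\<theta> (p l) * x l))"
        by (rule prod.cong) (auto simp: cis_mult algebra_simps)
      also have "\<dots> = cis (\<theta> (p j) * s) * (\<Prod>l<N. cis (\<theta> (p l) * x l))"
        using j by (simp add: prod.distrib prod.delta)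
      finally show ?thesis .
    qed
    then show ?thesis
      unfolding D_def slater_leibniz by (simp only: mult.left_commute)
  qed
  have two_cos: "cis (a * 1) + cis (a * - 1) = complex_of_real (2 * cos a)" for a :: real
    by (simp add: complex_eq_iff)
  have "(\<Sum>j<N. D (x(j := x j + 1)) + D (x(j := x j - 1)))
      = (\<Sum>j<N. D (x(j := x j + 1)) + D (x(j := x j + - 1)))"
    by simp
  also have "\<dots> = (\<Sum>j<N. \<Sum>p | p permutes {0..<N}.
      complex_of_real (2 * cos (\<theta> (p j))) * (signof p * (\<Prod>l<N. cis (\<theta> (p l) * x l))))"
  proof (rule sum.cong[OF refl])
    fix j assume "j \<in> {..<N}"
    then have j: "j < N" by simp
    show "D (x(j := x j + 1)) + D (x(j := x j + - 1)) = (\<Sum>p | p permutes {0..<N}.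
      complex_of_real (2 * cos (\<theta> (p j))) * (signof p * (\<Prod>l<N. cis (\<theta> (p l) * x l))))"
      unfolding shift[OF j] two_cos[symmetric]
      by (simp only: sum.distrib[symmetric] distrib_right)
  qed
  also have "\<dots> = (\<Sum>p | p permutes {0..<N}. \<Sum>j<N.
      complex_of_real (2 * cos (\<theta> (p j))) * (signof p * (\<Prod>l<N. cis (\<theta> (p l) * x l))))"
    by (rule sum.swap)
  also have "\<dots> = (\<Sum>p | p permutes {0..<N}. complex_of_real (\<Sum>i<N. 2 * cos (\<theta> i)) *
      (signof p * (\<Prod>l<N. cis (\<theta> (p l) * x l))))"
  proof (rule sum.cong[OF refl])
    fix p assume "p \<in> {p. p permutes {0..<N}}"
    then have "bij_betw p {..<N} {..<N}"
      using permutes_imp_bij by (auto simp: atLeast0LessThan)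
    then have "(\<Sum>j<N. 2 * cos (\<theta> (p j))) = (\<Sum>i<N. 2 * cos (\<theta> i))"
      by (rule sum.reindex_bij_betw)
    then show "(\<Sum>j<N. complex_of_real (2 * cos (\<theta> (p j))) * (signof p * (\<Prod>l<N. cis (\<theta> (p l) * x l))))
      = complex_of_real (\<Sum>i<N. 2 * cos (\<theta> i)) * (signof p * (\<Prod>l<N. cis (\<theta> (p l) * x l)))"
      by (simp only: sum_distrib_right[symmetric] of_real_sum[symmetric])
  qed
  also have "\<dots> = complex_of_real (\<Sum>i<N. 2 * cos (\<theta> i)) * D x"
    by (simp only: D_def slater_leibniz sum_distrib_left)
  finally show ?thesis .
qed

section \<open>Particles of a configuration\<close>

lemma enumerations_differ_by_permutation:
  fixes N :: nat
  assumes x: "bij_betw x {..<N} \<zeta>" and e: "bij_betw e {..<N} \<zeta>"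
  obtains p where "p permutes {0..<N}" "\<And>j. j < N \<Longrightarrow> e j = x (p j)"
proof -
  define p where "p j = (if j < N then inv_into {..<N} x (e j) else j)" for j
  have "bij_betw (inv_into {..<N} x \<circ> e) {..<N} {..<N}"
    by (rule bij_betw_trans[OF e bij_betw_inv_into[OF x]])
  then have "bij_betw p {..<N} {..<N}"
    by (rule bij_betw_cong[THEN iffD1, rotated]) (auto simp: p_def)
  then have "p permutes {0..<N}"
    by (intro bij_imp_permutes) (auto simp: p_def atLeast0LessThan)
  moreover have "e j = x (p j)" if "j < N" for j
    using bij_betw_inv_into_right[OF x, of "e j"] bij_betwE[OF e] that by (auto simp: p_def)
  ultimately show ?thesis by (rule that)
qed

definition particle :: "nat set \<Rightarrow> nat \<Rightarrow> nat" where
  "particle \<eta> j = sorted_list_of_set \<eta> ! j"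

lemma finite_configs: "finite (configs L N)"
  by (rule finite_subset[of _ "Pow {..<L}"]) (auto simp: configs_def)

lemma finite_config: "\<eta> \<in> configs L N \<Longrightarrow> finite \<eta>"
  by (auto simp: configs_def intro: finite_subset)

lemma config_subset: "\<xi> \<in> configs L N \<Longrightarrow> \<xi> \<subseteq> {..<L}"
  by (simp add: configs_def)

lemma bij_betw_particle:
  assumes "\<eta> \<in> configs L N"
  shows "bij_betw (particle \<eta>) {..<N} \<eta>"
  unfolding particle_def using assms finite_config[OF assms]
  by (intro bij_betw_nth) (auto simp: configs_def)

lemma particle_strict:
  assumes "\<eta> \<in> configs L N" "i < j" "j < N"
  shows "particle \<eta> i < particle \<eta> j"
  unfolding particle_def using assms finite_config[OF assms(1)]
  by (intro sorted_wrt_nth_less[where P = "(<)"]) (auto simp: configs_def)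

lemma particle_less:
  assumes "\<eta> \<in> configs L N" "j < N"
  shows "particle \<eta> j < L"
  using bij_betwE[OF bij_betw_particle[OF assms(1)]] assms by (auto simp: configs_def)

section \<open>Orthonormal families from determinants\<close>

text \<open>
  Andreief's identity, a form of the Cauchy--Binet formula. Expanding the right-hand side by
  multilinearity gives a sum over all tuples of sites. A tuple with a repeated site contributes
  nothing, and an injective tuple is a reordering of exactly one configuration; the sum over the
  reorderings is the Leibniz expansion of the second determinant.
\<close>

lemma sum_configs_slater_mult_slater:
  fixes f g :: "nat \<Rightarrow> nat \<Rightarrow> 'a :: comm_ring_1"
  shows "(\<Sum>\<eta>\<in>configs L N. slater N f (particle \<eta>) * slater N g (particle \<eta>))
       = det (mat N N (\<lambda>(i, j). \<Sum>x<L. f i x * g j x))"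
proof -
  let ?E = "PiE {..<N} (\<lambda>_. {..<L})"
  let ?perms = "{p. p permutes {0..<N}}"
  define F where "F e = slater N f e * (\<Prod>j<N. g j (e j))" for e
  have finE: "finite ?E" by (intro finite_PiE) auto
  have "det (mat N N (\<lambda>(i, j). \<Sum>x<L. f i x * g j x))
      = slater N (\<lambda>i j. \<Sum>x<L. f i x * g j x) (\<lambda>j. j)"
    by (simp add: slater_def)
  also have "\<dots> = (\<Sum>p\<in>?perms. signof p * (\<Prod>j<N. \<Sum>x<L. f (p j) x * g j x))"
    by (rule slater_leibniz)
  also have "\<dots> = (\<Sum>p\<in>?perms. \<Sum>e\<in>?E. signof p * (\<Prod>j<N. f (p j) (e j) * g j (e j)))"
    by (simp add: prod_sum_PiE sum_distrib_left)
  also have "\<dots> = (\<Sum>e\<in>?E. \<Sum>p\<in>?perms. signof p * (\<Prod>j<N. f (p j) (e j) * g j (e j)))"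
    by (rule sum.swap)
  also have "\<dots> = (\<Sum>e\<in>?E. F e)"
    by (simp only: F_def slater_leibniz sum_distrib_right prod.distrib mult.assoc)
  also have "\<dots> = (\<Sum>e\<in>{e\<in>?E. inj_on e {..<N}}. F e)"
  proof (rule sum.mono_neutral_right)
    show "\<forall>e\<in>?E - {e\<in>?E. inj_on e {..<N}}. F e = 0"
    proof
      fix e assume "e \<in> ?E - {e\<in>?E. inj_on e {..<N}}"
      then obtain a b where "a < N" "b < N" "a \<noteq> b" "e a = e b"
        by (auto simp: inj_on_def)
      then have "slater N f e = 0" by (intro slater_repeated_point[of a N b]) auto
      then show "F e = 0" by (simp add: F_def)
    qed
  qed (use finE in auto)
  also have "\<dots> = (\<Sum>\<eta>\<in>configs L N. \<Sum>e | e \<in> {e\<in>?E. inj_on e {..<N}} \<and> e ` {..<N} = \<eta>. F e)"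
  proof (rule sum.group[where g = "\<lambda>e. e ` {..<N}", symmetric])
    show "(\<lambda>e. e ` {..<N}) ` {e\<in>?E. inj_on e {..<N}} \<subseteq> configs L N"
      by (auto simp: configs_def card_image PiE_def Pi_def)
  qed (use finE finite_configs in auto)
  also have "\<dots> = (\<Sum>\<eta>\<in>configs L N. \<Sum>p\<in>?perms. F (particle \<eta> \<circ> p))"
  proof (rule sum.cong[OF refl])
    fix \<eta> assume \<eta>: "\<eta> \<in> configs L N"
    \<comment> \<open>the elements of \<open>PiE\<close> are undefined outside their domain, hence the restriction\<close>
    let ?r = "\<lambda>p. restrict (particle \<eta> \<circ> p) {..<N}"
    let ?B = "{e. e \<in> {e\<in>?E. inj_on e {..<N}} \<and> e ` {..<N} = \<eta>}"
    note pb = bij_betw_particle[OF \<eta>]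
    have perm_bij: "bij_betw p {..<N} {..<N}" if "p permutes {0..<N}" for p
      using permutes_imp_bij[OF that] by (simp add: atLeast0LessThan)
    have "bij_betw ?r ?perms ?B"
      unfolding bij_betw_def
    proof (intro conjI)
      show "inj_on ?r ?perms"
      proof (rule inj_onI)
        fix p q assume pq: "p \<in> ?perms" "q \<in> ?perms" "?r p = ?r q"
        show "p = q"
        proof
          fix j
          show "p j = q j"
          proof (cases "j < N")
            case True
            then have "particle \<eta> (p j) = particle \<eta> (q j)" using fun_cong[OF pq(3), of j] by simp
            moreover have "p j < N" "q j < N"
              using True pq bij_betwE[OF perm_bij] by auto
            ultimately show ?thesis using pb by (auto simp: bij_betw_def inj_on_def)
          next
            case False
            then show ?thesis using pq by (simp add: permutes_def)
          qed
        qed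
      qed
      show "?r ` ?perms = ?B"
      proof (intro subset_antisym subsetI)
        fix e assume "e \<in> ?r ` ?perms"
        then obtain p where p: "p permutes {0..<N}" and e: "e = ?r p" by auto
        have b: "bij_betw e {..<N} \<eta>"
          using bij_betw_trans[OF perm_bij[OF p] pb]
          by (rule bij_betw_cong[THEN iffD1, rotated]) (auto simp: e)
        then have "e \<in> ?E"
          using \<eta> by (auto simp: e configs_def bij_betw_def PiE_def)
        then show "e \<in> ?B" using b by (auto simp: bij_betw_def)
      next
        fix e assume e: "e \<in> ?B"
        then have "bij_betw e {..<N} \<eta>" by (auto simp: bij_betw_def)
        then obtain p where p: "p permutes {0..<N}" "\<And>j. j < N \<Longrightarrow> e j = particle \<eta> (p j)"
          using enumerations_differ_by_permutation[OF pb] by blast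
        have "e = ?r p"
        proof
          fix j show "e j = ?r p j"
            using e p(2)[of j] by (cases "j < N") (auto simp: PiE_def extensional_def)
        qed
        then show "e \<in> ?r ` ?perms" using p(1) by blast
      qed
    qed
    then have "(\<Sum>e\<in>?B. F e) = (\<Sum>p\<in>?perms. F (?r p))"
      by (rule sum.reindex_bij_betw[symmetric])
    also have "\<dots> = (\<Sum>p\<in>?perms. F (particle \<eta> \<circ> p))"
      unfolding F_def
      by (intro sum.cong refl arg_cong2[where f = "(*)"] prod.cong slater_cong) auto
    finally show "(\<Sum>e\<in>?B. F e) = (\<Sum>p\<in>?perms. F (particle \<eta> \<circ> p))" .
  qed
  also have "\<dots> = (\<Sum>\<eta>\<in>configs L N. slater N f (particle \<eta>) * slater N g (particle \<eta>))"
  proof (rule sum.cong[OF refl])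
    fix \<eta>
    have "(\<Sum>p\<in>?perms. F (particle \<eta> \<circ> p))
        = (\<Sum>p\<in>?perms. slater N f (particle \<eta>) * (signof p * (\<Prod>j<N. g j (particle \<eta> (p j)))))"
      by (rule sum.cong[OF refl]) (simp add: F_def slater_permute)
    also have "\<dots> = slater N f (particle \<eta>) * slater N g (particle \<eta>)"
      by (simp only: slater_leibniz_rows[of N g] sum_distrib_left)
    finally show "(\<Sum>p\<in>?perms. F (particle \<eta> \<circ> p)) = slater N f (particle \<eta>) * slater N g (particle \<eta>)" .
  qed
  finally show ?thesis by simp
qed

text \<open>
  Orthonormality says that a square matrix \<open>A\<close> has a right inverse \<open>B\<close>. Then \<open>B\<close> is also a left
  inverse, and \<open>B * A = 1\<close> says that each function is the sum of its projections.
\<close>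

lemma orthonormal_family_spans:
  assumes fin: "finite S" "finite I" and card: "card I = card S"
    and ortho: "\<And>i j. i \<in> I \<Longrightarrow> j \<in> I \<Longrightarrow> l2_inner S w (e i) (e j) = (if i = j then 1 else 0)"
  shows "l2_orthonormal_basis S w I e"
proof -
  define n where "n = card S"
  obtain a where a: "bij_betw a {0..<n} I"
    using ex_bij_betw_nat_finite[OF fin(2)] card n_def by auto
  obtain b where b: "bij_betw b {0..<n} S"
    using ex_bij_betw_nat_finite[OF fin(1)] n_def by auto
  define A where "A = mat n n (\<lambda>(i, j). e (a i) (b j))"
  define B where "B = mat n n (\<lambda>(j, i). cnj (e (a i) (b j)) * complex_of_real (w (b j)))"
  have carr: "A \<in> carrier_mat n n" "B \<in> carrier_mat n n" by (auto simp: A_def B_def)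
  have "A * B = 1\<^sub>m n"
  proof (rule eq_matI)
    fix i j assume ij: "i < dim_row (1\<^sub>m n :: complex mat)" "j < dim_col (1\<^sub>m n :: complex mat)"
    then have ij': "i < n" "j < n" by auto
    have "(A * B) $$ (i, j) = (\<Sum>k = 0..<n. e (a i) (b k) * (cnj (e (a j) (b k)) * complex_of_real (w (b k))))"
      using ij' by (simp add: A_def B_def scalar_prod_def)
    also have "\<dots> = (\<Sum>x\<in>S. e (a i) x * (cnj (e (a j) x) * complex_of_real (w x)))"
      by (rule sum.reindex_bij_betw[OF b])
    also have "\<dots> = l2_inner S w (e (a i)) (e (a j))"
      by (simp add: l2_inner_def mult.assoc)
    also have "\<dots> = (if a i = a j then 1 else 0)"
      using ij' bij_betwE[OF a] by (intro ortho) auto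
    also have "\<dots> = (if i = j then 1 else 0)"
      using a ij' by (auto simp: bij_betw_def inj_on_def)
    finally show "(A * B) $$ (i, j) = 1\<^sub>m n $$ (i, j)" using ij' by simp
  qed (auto simp: A_def B_def)
  then have BA: "B * A = 1\<^sub>m n"
    by (rule mat_mult_left_right_inverse[OF carr])
  have "\<exists>c. \<forall>x\<in>S. f x = (\<Sum>i\<in>I. c i * e i x)" for f
  proof (intro exI ballI)
    fix y assume "y \<in> S"
    then obtain l where l: "l < n" "y = b l" using b by (auto simp: bij_betw_def)
    have "(\<Sum>i\<in>I. l2_inner S w f (e i) * e i y)
        = (\<Sum>i = 0..<n. l2_inner S w f (e (a i)) * e (a i) y)"
      by (rule sum.reindex_bij_betw[OF a, symmetric])
    also have "\<dots> = (\<Sum>i = 0..<n. \<Sum>k = 0..<n. f (b k) * cnj (e (a i) (b k)) * complex_of_real (w (b k)) * e (a i) y)"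
      unfolding l2_inner_def sum_distrib_right
      by (rule sum.cong[OF refl], rule sum.reindex_bij_betw[OF b, symmetric])
    also have "\<dots> = (\<Sum>k = 0..<n. \<Sum>i = 0..<n. f (b k) * cnj (e (a i) (b k)) * complex_of_real (w (b k)) * e (a i) y)"
      by (rule sum.swap)
    also have "\<dots> = (\<Sum>k = 0..<n. f (b k) * (B * A) $$ (k, l))"
      using l by (intro sum.cong refl) (simp add: A_def B_def scalar_prod_def sum_distrib_left mult.assoc)
    also have "\<dots> = (\<Sum>k = 0..<n. if k = l then f (b k) else 0)"
      using l by (intro sum.cong refl) (simp add: BA)
    also have "\<dots> = f y" using l by simp
    finally show "f y = (\<Sum>i\<in>I. l2_inner S w f (e i) * e i y)" by simp
  qed
  then show ?thesis
    unfolding l2_orthonormal_basis_def using fin ortho by blast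
qed

section \<open>Partitions in a box and configurations\<close>

definition exponent :: "nat \<Rightarrow> nat list \<Rightarrow> nat \<Rightarrow> nat" where
  "exponent N lam i = lam ! i + (N - 1 - i)"

lemma exponent_strict:
  assumes "lam \<in> partitions_in_box N M" "i < j" "j < N"
  shows "exponent N lam j < exponent N lam i"
proof -
  have "lam ! j \<le> lam ! i"
    using assms by (auto simp: partitions_in_box_def sorted_wrt_iff_nth_less)
  then show ?thesis using assms by (simp add: exponent_def)
qed

lemma exponent_less:
  assumes "lam \<in> partitions_in_box N (L - N)" "N \<le> L" "i < N"
  shows "exponent N lam i < L"
proof -
  have "lam ! i \<le> L - N" using assms by (auto simp: partitions_in_box_def)
  then show ?thesis using assms by (simp add: exponent_def)
qed

lemma inj_on_exponent:
  assumes "lam \<in> partitions_in_box N M"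
  shows "inj_on (exponent N lam) {..<N}"
  by (rule linorder_inj_onI) (auto dest: exponent_strict[OF assms])

text \<open>
  The exponents decrease in their index, while \<open>particle\<close> lists a set increasingly.
\<close>

lemma particle_exponent_image:
  assumes lam: "lam \<in> partitions_in_box N M" and j: "j < N"
  shows "particle (exponent N lam ` {..<N}) (N - 1 - j) = exponent N lam j"
proof -
  let ?l = "map (\<lambda>j. exponent N lam (N - 1 - j)) [0..<N]"
  have "set ?l = exponent N lam ` {..<N}"
  proof -
    have "(\<lambda>j. N - 1 - j) ` {0..<N} = {..<N}"
    proof (intro subset_antisym subsetI)
      fix i assume "i \<in> {..<N}"
      then show "i \<in> (\<lambda>j. N - 1 - j) ` {0..<N}"
        by (intro image_eqI[of _ _ "N - 1 - i"]) auto
    qed auto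
    then show ?thesis by (simp only: set_map set_upt image_image[symmetric])
  qed
  moreover have "sorted_wrt (<) ?l"
    by (auto simp: sorted_wrt_iff_nth_less intro!: exponent_strict[OF lam])
  moreover have "card (exponent N lam ` {..<N}) = N"
    using inj_on_exponent[OF lam] by (simp add: card_image)
  ultimately have "sorted_list_of_set (exponent N lam ` {..<N}) = ?l"
    by (intro sorted_list_of_set_unique[THEN iffD1]) auto
  then show ?thesis using j by (simp add: particle_def)
qed

lemma particle_gap:
  assumes \<eta>: "\<eta> \<in> configs L N" and "i \<le> j" "j < N"
  shows "particle \<eta> i + (j - i) \<le> particle \<eta> j"
  using assms(2,3)
proof (induction j rule: dec_induct)
  case (step n)
  have "particle \<eta> n < particle \<eta> (Suc n)" using step by (intro particle_strict[OF \<eta>]) auto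
  then show ?case using step by simp
qed simp

text \<open>
  Adding the staircase \<open>N - 1, \<dots>, 1, 0\<close> makes a weakly decreasing list strictly decreasing, and a
  strictly decreasing list is the same as a set. The inverse map subtracts from the position of
  each particle the number of particles to its left.
\<close>

lemma bij_betw_partitions_configs:
  assumes "N \<le> L"
  shows "bij_betw (\<lambda>lam. exponent N lam ` {..<N}) (partitions_in_box N (L - N)) (configs L N)"
  unfolding bij_betw_def
proof (intro conjI inj_onI subset_antisym subsetI)
  fix lam mu
  assume lam: "lam \<in> partitions_in_box N (L - N)" and mu: "mu \<in> partitions_in_box N (L - N)"
    and eq: "exponent N lam ` {..<N} = exponent N mu ` {..<N}"
  have "lam ! i = mu ! i" if "i < N" for i
    using particle_exponent_image[OF lam that] particle_exponent_image[OF mu that] eq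
    by (simp add: exponent_def)
  moreover have "length lam = N" "length mu = N"
    using lam mu by (auto simp: partitions_in_box_def)
  ultimately show "lam = mu" by (intro nth_equalityI) auto
next
  fix \<eta> assume "\<eta> \<in> (\<lambda>lam. exponent N lam ` {..<N}) ` partitions_in_box N (L - N)"
  then obtain lam where lam: "lam \<in> partitions_in_box N (L - N)" and "\<eta> = exponent N lam ` {..<N}"
    by auto
  then show "\<eta> \<in> configs L N"
    using inj_on_exponent[OF lam] exponent_less[OF lam assms]
    by (auto simp: configs_def card_image)
next
  fix \<eta> assume \<eta>: "\<eta> \<in> configs L N"
  define lam where "lam = map (\<lambda>i. particle \<eta> (N - 1 - i) - (N - 1 - i)) [0..<N]"
  have low: "j \<le> particle \<eta> j" if "j < N" for j
    using particle_gap[OF \<eta>, of 0 j] that by simp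
  have exp: "exponent N lam i = particle \<eta> (N - 1 - i)" if "i < N" for i
    using low[of "N - 1 - i"] that by (simp add: exponent_def lam_def)
  have "exponent N lam ` {..<N} = particle \<eta> ` {..<N}"
  proof (intro subset_antisym subsetI)
    fix y assume "y \<in> particle \<eta> ` {..<N}"
    then obtain j where j: "j < N" "y = particle \<eta> j" by auto
    then have "y = exponent N lam (N - 1 - j)" by (simp add: exp)
    then show "y \<in> exponent N lam ` {..<N}" using j by auto
  qed (auto simp: exp)
  then have image: "\<eta> = exponent N lam ` {..<N}"
    using bij_betw_particle[OF \<eta>] by (simp add: bij_betw_def)
  have mono: "particle \<eta> i - i \<le> particle \<eta> j - j" if "i \<le> j" "j < N" for i j
    using particle_gap[OF \<eta> that] low[of i] that by linarith
  have "lam \<in> partitions_in_box N (L - N)"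
    unfolding partitions_in_box_def
  proof (intro CollectI conjI ballI)
    show "sorted_wrt (\<ge>) lam"
      unfolding sorted_wrt_iff_nth_less
    proof (intro allI impI)
      fix i j assume "i < j" "j < length lam"
      then show "lam ! j \<le> lam ! i"
        using mono[of "N - 1 - j" "N - 1 - i"] by (simp add: lam_def)
    qed
  next
    fix k assume "k \<in> set lam"
    then obtain i where i: "i < N" "k = particle \<eta> (N - 1 - i) - (N - 1 - i)"
      by (auto simp: lam_def)
    define j where "j = N - 1 - i"
    have j: "j < N" "k = particle \<eta> j - j"
      using i by (auto simp: j_def)
    then have "k \<le> particle \<eta> (N - 1) - (N - 1)"
      using mono[of j "N - 1"] by simp
    moreover have "particle \<eta> (N - 1) < L" using j by (intro particle_less[OF \<eta>]) auto
    ultimately show "k \<le> L - N" by linarith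
  qed (simp add: lam_def)
  then show "\<eta> \<in> (\<lambda>lam. exponent N lam ` {..<N}) ` partitions_in_box N (L - N)"
    using image by blast
qed

section \<open>Orthogonality of Schur functions on the roots of unity\<close>

lemma schur_eq_ratio:
  "schur N lam X = slater N (\<lambda>i t. t ^ exponent N lam i) X / vandermonde N X"
  by (simp add: schur_def slater_def vandermonde_def exponent_def)

text \<open>
  At a repeated point both determinants vanish, so the identity survives the division by zero
  in the Schur function.
\<close>

lemma vandermonde_mult_schur:
  "vandermonde N X * schur N lam X = slater N (\<lambda>i t. t ^ exponent N lam i) X"
proof (cases "vandermonde N X = 0")
  case True
  then obtain a b where "a < N" "b < N" "a \<noteq> b" "X a = X b"
    by (auto simp: inj_on_def vandermonde_eq_0_iff)
  then have "slater N (\<lambda>i t. t ^ exponent N lam i) X = 0"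
    by (intro slater_repeated_point[of a N b]) auto
  then show ?thesis using True by simp
qed (simp add: schur_eq_ratio)

text \<open>
  The argument is real, and not a residue, so that a particle can be moved past either end of
  \<open>{0..<L}\<close> without being relabelled.
\<close>

definition unity_root :: "nat \<Rightarrow> real \<Rightarrow> complex" where
  "unity_root L t = cis (2 * pi * t / real L)"

lemma inj_on_unity_root:
  assumes "0 < L"
  shows "inj_on (\<lambda>k. unity_root L (real k)) {..<L}"
  using bij_betw_roots_unity[OF assms] by (auto simp: bij_betw_def unity_root_def)

text \<open>
  A geometric series whose ratio is an \<open>L\<close>-th root of unity.
\<close>

lemma characters_orthogonal:
  assumes "k < L" "l < L"
  shows "(\<Sum>x<L. unity_root L (real x) ^ k * cnj (unity_root L (real x) ^ l)) = (if k = l then of_nat L else 0)"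
proof -
  define z where "z = unity_root L (real k) / unity_root L (real l)"
  have powers: "unity_root L (real x) ^ k * cnj (unity_root L (real x) ^ l) = z ^ x" for x
    by (simp add: unity_root_def z_def DeMoivre cis_cnj cis_mult cis_divide
        diff_divide_distrib right_diff_distrib mult_ac)
  have "z ^ L = 1"
  proof -
    have "unity_root L (real k) ^ L = 1" for k
      using assms by (simp add: unity_root_def DeMoivre)
    then show ?thesis by (simp add: z_def power_divide)
  qed
  moreover have "z \<noteq> 1" if "k \<noteq> l"
    using inj_on_unity_root[of L] assms that
    by (auto simp: z_def inj_on_def unity_root_def)
  ultimately have "(\<Sum>x<L. z ^ x) = (if k = l then of_nat L else 0)"
    by (cases "k = l") (auto simp: geometric_sum z_def unity_root_def)
  then show ?thesis by (simp only: powers)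
qed

abbreviation roots_of :: "nat \<Rightarrow> nat set \<Rightarrow> nat \<Rightarrow> complex" where
  "roots_of L \<eta> \<equiv> (\<lambda>j. unity_root L (real (particle \<eta> j)))"

lemma schur_config_eq:
  "schur_config L N lam \<eta> = schur N lam (\<lambda>j. unity_root L (real (particle \<eta> j)))"
proof -
  have "exp (2 * \<i> * complex_of_real pi * of_nat n / of_nat L) = unity_root L (real n)" for n
    by (simp add: unity_root_def cis_conv_exp mult_ac)
  then show ?thesis by (simp add: schur_config_def particle_def)
qed

lemma cnj_slater: "cnj (slater N f x) = slater N (\<lambda>i t. cnj (f i t)) x"
  by (simp add: slater_leibniz)

text \<open>
  The squared modulus of the Vandermonde determinant cancels both denominators, and Andreief's
  identity turns the sum into the determinant of the Gram matrix of the characters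
  \<open>x \<mapsto> \<omega> ^ (k * x)\<close>, with \<open>k\<close> an exponent of one of the two partitions. These characters are
  orthogonal. For equal partitions the matrix is \<open>L\<close> times the identity; for different ones some
  exponent of the first is not an exponent of the second, and its row is zero.
\<close>

lemma schur_config_orthogonal:
  assumes lam: "lam \<in> partitions_in_box N (L - N)" and mu: "mu \<in> partitions_in_box N (L - N)"
    and NL: "N \<le> L"
  shows "(\<Sum>\<eta>\<in>configs L N. schur_config L N lam \<eta> * cnj (schur_config L N mu \<eta>)
            * complex_of_real ((cmod (vandermonde N (roots_of L \<eta>)))\<^sup>2))
       = (if lam = mu then of_nat L ^ N else 0)"
proof -
  let ?f = "\<lambda>i x. unity_root L (real x) ^ exponent N lam i"
  let ?g = "\<lambda>i x. cnj (unity_root L (real x) ^ exponent N mu i)"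
  let ?G = "mat N N (\<lambda>(i, j). \<Sum>x<L. ?f i x * ?g j x)"
  have "(\<Sum>\<eta>\<in>configs L N. schur_config L N lam \<eta> * cnj (schur_config L N mu \<eta>)
            * complex_of_real ((cmod (vandermonde N (roots_of L \<eta>)))\<^sup>2))
      = (\<Sum>\<eta>\<in>configs L N. slater N ?f (particle \<eta>) * slater N ?g (particle \<eta>))"
  proof (rule sum.cong[OF refl])
    fix \<eta>
    let ?V = "vandermonde N (roots_of L \<eta>)"
    have num: "?V * schur_config L N lam \<eta> = slater N (\<lambda>i x. unity_root L (real x) ^ exponent N lam i) (particle \<eta>)" for lam
      by (simp add: schur_config_eq vandermonde_mult_schur slater_def)
    have "schur_config L N lam \<eta> * cnj (schur_config L N mu \<eta>) * complex_of_real ((cmod ?V)\<^sup>2)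
        = (?V * schur_config L N lam \<eta>) * cnj (?V * schur_config L N mu \<eta>)"
      by (simp only: complex_norm_square complex_cnj_mult mult_ac)
    also have "\<dots> = slater N ?f (particle \<eta>) * slater N ?g (particle \<eta>)"
      by (simp only: num cnj_slater)
    finally show "schur_config L N lam \<eta> * cnj (schur_config L N mu \<eta>) * complex_of_real ((cmod ?V)\<^sup>2)
        = slater N ?f (particle \<eta>) * slater N ?g (particle \<eta>)" .
  qed
  also have "\<dots> = det ?G"
    by (rule sum_configs_slater_mult_slater)
  also have "?G = mat N N (\<lambda>(i, j). if exponent N lam i = exponent N mu j then of_nat L else 0)"
    by (rule eq_matI)
       (use exponent_less[OF lam NL] exponent_less[OF mu NL] in \<open>auto simp: characters_orthogonal simp del: complex_cnj_power\<close>)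
  also have "det \<dots> = (if lam = mu then of_nat L ^ N else 0)"
  proof (cases "lam = mu")
    case True
    have "mat N N (\<lambda>(i, j). if exponent N lam i = exponent N mu j then of_nat L else 0)
        = (of_nat L :: complex) \<cdot>\<^sub>m 1\<^sub>m N"
      using True inj_on_exponent[OF mu] by (intro eq_matI) (auto simp: inj_on_def)
    then show ?thesis using True by simp
  next
    case False
    have "\<not> exponent N lam ` {..<N} \<subseteq> exponent N mu ` {..<N}"
    proof
      assume "exponent N lam ` {..<N} \<subseteq> exponent N mu ` {..<N}"
      then have "exponent N lam ` {..<N} = exponent N mu ` {..<N}"
        by (rule card_subset_eq[rotated])
           (simp_all add: card_image inj_on_exponent[OF lam] inj_on_exponent[OF mu])
      then show False
        using bij_betw_partitions_configs[OF NL] lam mu False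
        by (auto simp: bij_betw_def inj_on_def)
    qed
    then obtain i where i: "i < N" "\<And>j. j < N \<Longrightarrow> exponent N lam i \<noteq> exponent N mu j"
      by auto
    let ?D = "mat N N (\<lambda>(i, j). if exponent N lam i = exponent N mu j then of_nat L else 0) :: complex mat"
    have "det ?D = (\<Sum>j<N. ?D $$ (i, j) * cofactor ?D i j)"
      by (rule laplace_expansion_row) (use i in auto)
    also have "\<dots> = 0"
      by (rule sum.neutral) (use i in auto)
    finally show ?thesis using False by simp
  qed
  finally show ?thesis .
qed

section \<open>Schur functions as plane waves\<close>

text \<open>
  Each index belongs to \<open>N - 1\<close> pairs.
\<close>

lemma prod_pairs_eq_prod_power:
  fixes a :: "nat \<Rightarrow> 'a :: comm_monoid_mult"
  shows "(\<Prod>l<N. \<Prod>j<l. a j * a l) = (\<Prod>j<N. a j ^ (N - 1))"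
proof (induction N)
  case (Suc N)
  have "(\<Prod>j<N. a j ^ (N - 1)) * (\<Prod>j<N. a j) = (\<Prod>j<N. a j ^ N)"
    unfolding prod.distrib[symmetric] by (rule prod.cong) (auto simp: power_minus_mult[unfolded One_nat_def])
  note absorb = this
  have "(\<Prod>l<Suc N. \<Prod>j<l. a j * a l) = (\<Prod>l<N. \<Prod>j<l. a j * a l) * (\<Prod>j<N. a j * a N)"
    by simp
  also have "\<dots> = ((\<Prod>j<N. a j ^ (N - 1)) * (\<Prod>j<N. a j)) * a N ^ N"
    unfolding Suc by (simp only: prod.distrib prod_constant card_lessThan mult.assoc)
  also have "\<dots> = (\<Prod>j<Suc N. a j ^ (Suc N - 1))"
    by (simp add: absorb[simplified])
  finally show ?case .
qed simp

text \<open>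
  The chord between two points of the unit circle, factored into its direction and its length.
\<close>

lemma unity_root_diff:
  "unity_root L s - unity_root L t =
     (cis (pi * s / L) * cis (pi * t / L)) * (- \<i> * complex_of_real (2 * sin (pi * (t - s) / L)))"
proof -
  define a b where "a = pi * s / L" and "b = pi * t / L"
  have "2 * pi * s / L = a + a" "2 * pi * t / L = b + b" "pi * (t - s) / L = b - a"
    by (simp_all add: a_def b_def field_simps diff_divide_distrib)
  moreover have "cis (a + a) - cis (b + b) = (cis a * cis b) * (- \<i> * complex_of_real (2 * sin (b - a)))"
  proof -
    have "- \<i> * complex_of_real (2 * sin (b - a)) = cis (a - b) - cis (b - a)"
      using sin_minus[of "a - b"] cos_minus[of "a - b"] by (simp add: complex_eq_iff)
    then show ?thesis by (simp add: cis_mult right_diff_distrib)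
  qed
  ultimately show ?thesis
    by (simp only: unity_root_def a_def b_def)
qed

lemma vandermonde_unity_roots:
  "vandermonde N (\<lambda>j. unity_root L (x j)) =
     (\<Prod>j<N. cis (pi * x j / L) ^ (N - 1)) *
     (\<Prod>l<N. \<Prod>j<l. - \<i>) * complex_of_real (\<Prod>l<N. \<Prod>j<l. 2 * sin (pi * (x l - x j) / L))"
  unfolding vandermonde_eq_prod unity_root_diff prod_pairs_eq_prod_power[symmetric] of_real_prod
  by (simp only: prod.distrib mult.assoc)

text \<open>
  The product \<open>\<bar>V\<bar> * s\<close> of the modulus of the Vandermonde determinant and the Schur function. It
  is symmetric in the points and vanishes when two of them coincide, so it is a function of the
  configuration that extends by zero to forbidden positions.
\<close>

definition weighted_schur :: "nat \<Rightarrow> nat list \<Rightarrow> (nat \<Rightarrow> complex) \<Rightarrow> complex" where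
  "weighted_schur N lam X = complex_of_real (cmod (vandermonde N X)) * schur N lam X"

lemma weighted_schur_cong:
  assumes "\<And>j. j < N \<Longrightarrow> X j = Y j"
  shows "weighted_schur N lam X = weighted_schur N lam Y"
proof -
  have "vandermonde N X = vandermonde N Y"
    "slater N (\<lambda>i t. t ^ exponent N lam i) X = slater N (\<lambda>i t. t ^ exponent N lam i) Y"
    unfolding vandermonde_def by (intro slater_cong; simp add: assms)+
  then show ?thesis by (simp add: weighted_schur_def schur_eq_ratio)
qed

lemma weighted_schur_permute:
  assumes p: "p permutes {0..<N}"
  shows "weighted_schur N lam (X \<circ> p) = weighted_schur N lam X"
  unfolding weighted_schur_def schur_eq_ratio vandermonde_def slater_permute[OF p]
  by (simp add: sign_def norm_mult)

lemma weighted_schur_coincident: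
  assumes "a < N" "b < N" "a \<noteq> b" "X a = X b"
  shows "weighted_schur N lam X = 0"
proof -
  have "vandermonde N X = 0" using assms by (auto simp: vandermonde_eq_0_iff inj_on_def)
  then show ?thesis by (simp add: weighted_schur_def)
qed

text \<open>
  Factoring half the phase of each particle to the power \<open>N - 1\<close> out of the columns leaves the
  numerator of the Schur function, which is \<open>V * s\<close>. The same phases turn \<open>V\<close> into a product of
  sines times a power of \<open>- \<i>\<close>. The sines are nonnegative exactly because ordered points that
  span at most one period are at most half a turn apart in the angle \<open>pi * x / L\<close>, so their
  product is \<open>\<bar>V\<bar>\<close>. The bounds are not strict: coinciding points, and points one full period
  apart, must be covered.
\<close>

lemma plane_waves_eq_weighted_schur:
  fixes x :: "nat \<Rightarrow> real"
  assumes L: "0 < L"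
    and window: "\<And>j l. j < l \<Longrightarrow> l < N \<Longrightarrow> 0 \<le> x l - x j \<and> x l - x j \<le> L"
  shows "slater N (\<lambda>i t. cis (pi * (2 * real (exponent N lam i) - real (N - 1)) / L * t)) x
    = (\<Prod>l<N. \<Prod>j<l. - \<i>) * weighted_schur N lam (\<lambda>j. unity_root L (x j))"
proof -
  let ?X = "\<lambda>j. unity_root L (x j)"
  let ?S = "\<Prod>l<N. \<Prod>j<l. 2 * sin (pi * (x l - x j) / L)"
  let ?I = "\<Prod>l<N. \<Prod>j<l. - \<i>"
  \<comment> \<open>the inverse of half the phase of \<open>unity_root L t\<close>, to the power \<open>N - 1\<close>\<close>
  let ?u = "\<lambda>t. cis (- (pi * t / L)) ^ (N - 1)"
  have wave: "cis (pi * (2 * real k - real (N - 1)) / L * t) = ?u t * unity_root L t ^ k" for k t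
  proof -
    have "pi * (2 * real k - real (N - 1)) / L * t
        = real (N - 1) * - (pi * t / L) + real k * (2 * pi * t / L)"
      using L by (simp add: field_simps)
    then show ?thesis by (simp only: DeMoivre unity_root_def cis_mult)
  qed
  have "slater N (\<lambda>i t. cis (pi * (2 * real (exponent N lam i) - real (N - 1)) / L * t)) x
      = slater N (\<lambda>i t. ?u t * unity_root L t ^ exponent N lam i) x"
    by (simp only: wave)
  also have "\<dots> = (\<Prod>j<N. ?u (x j)) * slater N (\<lambda>i t. unity_root L t ^ exponent N lam i) x"
    by (rule slater_mult_columns)
  also have "slater N (\<lambda>i t. unity_root L t ^ exponent N lam i) x = vandermonde N ?X * schur N lam ?X"
    by (simp add: vandermonde_mult_schur slater_def)
  also have "(\<Prod>j<N. ?u (x j)) * (vandermonde N ?X * schur N lam ?X)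
      = ((\<Prod>j<N. ?u (x j)) * (\<Prod>j<N. cis (pi * x j / L) ^ (N - 1))) *
        (?I * (complex_of_real ?S * schur N lam ?X))"
    by (simp only: vandermonde_unity_roots mult.assoc)
  also have "(\<Prod>j<N. ?u (x j)) * (\<Prod>j<N. cis (pi * x j / L) ^ (N - 1)) = 1"
    by (simp add: prod.distrib[symmetric] power_mult_distrib[symmetric] cis_mult)
  also have "?S = cmod (vandermonde N ?X)"
  proof -
    have "?S \<ge> 0"
    proof (intro prod_nonneg ballI mult_nonneg_nonneg)
      fix l j assume "l \<in> {..<N}" "j \<in> {..<l}"
      then have w: "0 \<le> x l - x j" "x l - x j \<le> L" using window[of j l] by auto
      have "pi * (x l - x j) / L \<le> pi * L / L"
        using w L by (intro divide_right_mono mult_left_mono) auto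
      then show "0 \<le> sin (pi * (x l - x j) / L)"
        using w L by (intro sin_ge_zero) auto
    qed simp
    moreover have "cmod (vandermonde N ?X) = \<bar>?S\<bar>"
      by (simp only: vandermonde_unity_roots norm_mult norm_of_real prod_norm[symmetric] norm_power norm_cis)
         simp
    ultimately show ?thesis by simp
  qed
  finally show ?thesis by (simp add: weighted_schur_def)
qed

text \<open>
  A unit move of one point leads from the separated positions at worst to the boundary of the
  window in which plane waves and weighted Schur functions agree, so the eigenvalue equation for
  plane waves applies to the latter.
\<close>

lemma weighted_schur_laplacian:
  fixes x :: "nat \<Rightarrow> real"
  assumes L: "1 \<le> L"
    and sep: "\<And>j l. j < l \<Longrightarrow> l < N \<Longrightarrow> 1 \<le> x l - x j \<and> x l - x j \<le> real L - 1"
  shows "(\<Sum>j<N. weighted_schur N lam (\<lambda>l. unity_root L ((x(j := x j + 1)) l))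
              + weighted_schur N lam (\<lambda>l. unity_root L ((x(j := x j - 1)) l)))
    = complex_of_real (\<Sum>i<N. 2 * cos (pi * (2 * real (exponent N lam i) - real (N - 1)) / L))
      * weighted_schur N lam (\<lambda>l. unity_root L (x l))"
proof -
  let ?D = "slater N (\<lambda>i t. cis (pi * (2 * real (exponent N lam i) - real (N - 1)) / L * t))"
  let ?W = "\<lambda>x :: nat \<Rightarrow> real. weighted_schur N lam (\<lambda>l. unity_root L (x l))"
  define I where "I = (\<Prod>l<N. \<Prod>j<l. - \<i>)"
  have "I \<noteq> 0" by (simp add: I_def)
  have D: "?D y = I * ?W y" if "\<And>j l. j < l \<Longrightarrow> l < N \<Longrightarrow> 0 \<le> y l - y j \<and> y l - y j \<le> L"
    for y :: "nat \<Rightarrow> real"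
    unfolding I_def by (rule plane_waves_eq_weighted_schur) (use L that in auto)
  have Dx: "?D x = I * ?W x"
    by (rule D) (use sep in force)
  have Dmove: "?D (x(k := t)) = I * ?W (x(k := t))" if "\<bar>t - x k\<bar> \<le> 1" for k t
  proof (rule D)
    fix j l assume "j < l" "l < N"
    then show "0 \<le> (x(k := t)) l - (x(k := t)) j \<and> (x(k := t)) l - (x(k := t)) j \<le> L"
      using sep[of j l] that by auto
  qed
  have Dplus: "?D (x(k := x k + 1)) = I * ?W (x(k := x k + 1))" for k by (rule Dmove) simp
  have Dminus: "?D (x(k := x k - 1)) = I * ?W (x(k := x k - 1))" for k by (rule Dmove) simp
  have "I * (\<Sum>j<N. ?W (x(j := x j + 1)) + ?W (x(j := x j - 1)))
      = (\<Sum>j<N. ?D (x(j := x j + 1)) + ?D (x(j := x j - 1)))"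
    by (simp only: Dplus Dminus sum_distrib_left distrib_left)
  also have "\<dots> = complex_of_real (\<Sum>i<N. 2 * cos (pi * (2 * real (exponent N lam i) - real (N - 1)) / L)) * ?D x"
    by (rule slater_plane_waves_laplacian)
  finally show ?thesis
    using \<open>I \<noteq> 0\<close> unfolding Dx by (simp add: mult.left_commute)
qed

text \<open>
  By symmetry the particles may be listed in any order. This matters for a particle that crosses
  the end of \<open>{0..<L}\<close>, which goes from last to first place.
\<close>

lemma weighted_schur_enumeration:
  assumes "\<zeta> \<in> configs L N" and "bij_betw e {..<N} \<zeta>"
  shows "weighted_schur N lam (\<lambda>j. unity_root L (real (e j))) = weighted_schur N lam (roots_of L \<zeta>)"
proof -
  obtain p where p: "p permutes {0..<N}" "\<And>j. j < N \<Longrightarrow> e j = particle \<zeta> (p j)"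
    using enumerations_differ_by_permutation[OF bij_betw_particle[OF assms(1)] assms(2)] by blast
  have "weighted_schur N lam (\<lambda>j. unity_root L (real (e j))) = weighted_schur N lam (roots_of L \<zeta> \<circ> p)"
    by (rule weighted_schur_cong) (simp add: p)
  then show ?thesis by (simp add: weighted_schur_permute[OF p(1)])
qed

section \<open>Schur functions and the adjacency matrix\<close>

text \<open>
  The left neighbour is written with \<open>+ L\<close> because subtraction of naturals truncates at \<open>0\<close>. For
  \<open>L = 2\<close> the two neighbours are the same site.
\<close>

definition ring_neighbours :: "nat \<Rightarrow> nat \<Rightarrow> nat set" where
  "ring_neighbours L x = {(x + 1) mod L, (x + L - 1) mod L}"

lemma succ_mod:
  fixes x L :: nat
  assumes "x < L"
  shows "(x + 1) mod L = (if x + 1 = L then 0 else x + 1)"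
proof (cases "x + 1 = L")
  case False
  then have "x + 1 < L" using assms by simp
  then show ?thesis by simp
qed simp

lemma pred_mod:
  fixes x L :: nat
  assumes "x < L"
  shows "(x + L - 1) mod L = (if x = 0 then L - 1 else x - 1)"
proof (cases "x = 0")
  case False
  then have "x + L - 1 = (x - 1) + L" by simp
  then have "(x + L - 1) mod L = (x - 1) mod L" by (simp only: mod_add_self2)
  then show ?thesis using assms False by simp
qed (use assms in simp)

lemma ring_neighbours_iff:
  assumes "x < L" "y < L"
  shows "y \<in> ring_neighbours L x \<longleftrightarrow> y = (x + 1) mod L \<or> x = (y + 1) mod L"
proof -
  have "y = (x + L - 1) mod L \<longleftrightarrow> x = (y + 1) mod L"
    unfolding succ_mod[OF assms(2)] pred_mod[OF assms(1)] using assms by auto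
  then show ?thesis by (auto simp: ring_neighbours_def)
qed

lemma jump_in_configs:
  assumes "\<xi> \<in> configs L N" "x \<in> \<xi>" "y < L" "y \<notin> \<xi>"
  shows "insert y (\<xi> - {x}) \<in> configs L N"
proof -
  have "card \<xi> \<ge> 1" using assms finite_config[OF assms(1)] by (auto simp: Suc_le_eq card_gt_0_iff)
  then show ?thesis
    using assms finite_config[OF assms(1)] by (auto simp: configs_def)
qed

text \<open>
  An edge determines its jump: the site that is left and the site that is reached are the two
  elements of the symmetric difference of its ends.
\<close>

lemma sum_adj_eq_sum_jumps:
  fixes h :: "nat set \<Rightarrow> complex"
  assumes \<xi>: "\<xi> \<in> configs L N"
  shows "(\<Sum>\<zeta>\<in>configs L N. complex_of_real (adj L \<xi> \<zeta>) * h \<zeta>)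
       = (\<Sum>x\<in>\<xi>. \<Sum>y\<in>ring_neighbours L x - \<xi>. h (insert y (\<xi> - {x})))"
proof -
  let ?J = "Sigma \<xi> (\<lambda>x. ring_neighbours L x - \<xi>)"
  have nb_less: "y < L" if "x \<in> \<xi>" "y \<in> ring_neighbours L x" for x y
    using that config_subset[OF \<xi>] by (auto simp: ring_neighbours_def)
  have inj: "inj_on (\<lambda>(x, y). insert y (\<xi> - {x})) ?J"
  proof (rule inj_onI, clarify)
    fix x y x' y'
    assume "x \<in> \<xi>" "y \<notin> \<xi>" "x' \<in> \<xi>" "y' \<notin> \<xi>"
      and eq: "insert y (\<xi> - {x}) = insert y' (\<xi> - {x'})"
    then have "x \<notin> insert y (\<xi> - {x})" "x' \<notin> insert y' (\<xi> - {x'})"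
      "y \<in> insert y' (\<xi> - {x'})"
      by auto
    then show "x = x' \<and> y = y'"
      using \<open>x \<in> \<xi>\<close> \<open>y \<notin> \<xi>\<close> \<open>x' \<in> \<xi>\<close> eq by auto
  qed
  have image: "(\<lambda>(x, y). insert y (\<xi> - {x})) ` ?J = {\<zeta> \<in> configs L N. adjacent L \<xi> \<zeta>}"
  proof (intro subset_antisym subsetI)
    fix \<zeta> assume "\<zeta> \<in> (\<lambda>(x, y). insert y (\<xi> - {x})) ` ?J"
    then obtain x y where xy: "x \<in> \<xi>" "y \<in> ring_neighbours L x" "y \<notin> \<xi>" "\<zeta> = insert y (\<xi> - {x})"
      by auto
    then have "x < L" "y < L" using nb_less config_subset[OF \<xi>] by auto
    then have "adjacent L \<xi> \<zeta>"
      unfolding adjacent_def using xy ring_neighbours_iff by blast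
    then show "\<zeta> \<in> {\<zeta> \<in> configs L N. adjacent L \<xi> \<zeta>}"
      using jump_in_configs[OF \<xi>] xy \<open>y < L\<close> by auto
  next
    fix \<zeta> assume "\<zeta> \<in> {\<zeta> \<in> configs L N. adjacent L \<xi> \<zeta>}"
    then obtain x y where xy: "x \<in> \<xi>" "y < L" "y \<notin> \<xi>" "y = (x + 1) mod L \<or> x = (y + 1) mod L"
      "\<zeta> = insert y (\<xi> - {x})"
      by (auto simp: adjacent_def)
    moreover have "x < L" using xy config_subset[OF \<xi>] by auto
    ultimately have "(x, y) \<in> ?J" using ring_neighbours_iff by auto
    then show "\<zeta> \<in> (\<lambda>(x, y). insert y (\<xi> - {x})) ` ?J" using xy by force
  qed
  have "(\<Sum>\<zeta>\<in>configs L N. complex_of_real (adj L \<xi> \<zeta>) * h \<zeta>)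
      = (\<Sum>\<zeta>\<in>configs L N. if adjacent L \<xi> \<zeta> then h \<zeta> else 0)"
    by (rule sum.cong) (auto simp: adj_def)
  also have "\<dots> = (\<Sum>\<zeta> | \<zeta> \<in> configs L N \<and> adjacent L \<xi> \<zeta>. h \<zeta>)"
    by (simp add: sum.inter_filter finite_configs)
  also have "\<dots> = (\<Sum>z\<in>?J. h ((\<lambda>(x, y). insert y (\<xi> - {x})) z))"
    unfolding image[symmetric] by (simp add: sum.reindex[OF inj])
  also have "\<dots> = (\<Sum>(x, y)\<in>?J. h (insert y (\<xi> - {x})))"
    by (simp add: case_prod_unfold)
  also have "\<dots> = (\<Sum>x\<in>\<xi>. \<Sum>y\<in>ring_neighbours L x - \<xi>. h (insert y (\<xi> - {x})))"
    by (rule sum.Sigma[symmetric])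
       (use finite_config[OF \<xi>] in \<open>auto simp: ring_neighbours_def\<close>)
  finally show ?thesis .
qed

lemma unity_root_shift: "0 < L \<Longrightarrow> unity_root L (t + real L * real m) = unity_root L t"
proof -
  assume "0 < L"
  then have "2 * pi * (t + real L * real m) / real L = 2 * pi * t / real L + 2 * pi * real m"
    by (simp add: field_simps)
  then show ?thesis by (simp add: unity_root_def cis_mult[symmetric] cis_multiple_2pi)
qed

lemma unity_root_mod:
  assumes "0 < L"
  shows "unity_root L (real (n mod L)) = unity_root L (real n)"
proof -
  have "real n = real (n mod L) + real L * real (n div L)"
    by (metis of_nat_add of_nat_mult mod_mult_div_eq)
  then show ?thesis using unity_root_shift[OF assms] by metis
qed

text \<open>
  If the target is occupied then two points coincide and the value is zero; otherwise the new
  list of points enumerates the new configuration.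
\<close>

lemma weighted_schur_jump:
  assumes L: "2 \<le> L" and \<xi>: "\<xi> \<in> configs L N" and j: "j < N"
    and y: "y \<in> ring_neighbours L (particle \<xi> j)"
  shows "weighted_schur N lam (\<lambda>l. unity_root L (real (if l = j then y else particle \<xi> l)))
       = (if y \<in> \<xi> then 0 else weighted_schur N lam (roots_of L (insert y (\<xi> - {particle \<xi> j}))))"
proof -
  note b = bij_betw_particle[OF \<xi>]
  have xL: "particle \<xi> j < L" by (rule particle_less[OF \<xi> j])
  then have yL: "y < L" using y by (auto simp: ring_neighbours_def)
  have neq: "y \<noteq> particle \<xi> j"
  proof
    assume "y = particle \<xi> j"
    then have "particle \<xi> j = (particle \<xi> j + 1) mod L"
      using y ring_neighbours_iff[OF xL yL] by auto
    then show False using xL L unfolding succ_mod[OF xL] by (simp split: if_splits)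
  qed
  show ?thesis
  proof (cases "y \<in> \<xi>")
    case True
    then obtain l where l: "l < N" "particle \<xi> l = y"
      using b unfolding bij_betw_def by (metis imageE lessThan_iff)
    then have "l \<noteq> j" using neq by auto
    then have "weighted_schur N lam (\<lambda>l. unity_root L (real (if l = j then y else particle \<xi> l))) = 0"
      by (intro weighted_schur_coincident[of l N j]) (use l j in auto)
    then show ?thesis using True by simp
  next
    case False
    let ?\<zeta> = "insert y (\<xi> - {particle \<xi> j})"
    have "bij_betw (\<lambda>l. if l = j then y else particle \<xi> l) {..<N} ?\<zeta>"
      unfolding bij_betw_def
    proof
      show "inj_on (\<lambda>l. if l = j then y else particle \<xi> l) {..<N}"
        using b False by (auto simp: inj_on_def bij_betw_def)
      show "(\<lambda>l. if l = j then y else particle \<xi> l) ` {..<N} = ?\<zeta>"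
      proof (intro subset_antisym subsetI)
        fix z assume "z \<in> (\<lambda>l. if l = j then y else particle \<xi> l) ` {..<N}"
        then show "z \<in> ?\<zeta>"
          using b j by (auto simp: bij_betw_def inj_on_def)
      next
        fix z assume z: "z \<in> ?\<zeta>"
        show "z \<in> (\<lambda>l. if l = j then y else particle \<xi> l) ` {..<N}"
        proof (cases "z = y")
          case True
          then show ?thesis using j by (intro image_eqI[of _ _ j]) auto
        next
          case False
          then obtain l where "l < N" "z = particle \<xi> l" using z b by (auto simp: bij_betw_def)
          then show ?thesis using z False by (intro image_eqI[of _ _ l]) auto
        qed
      qed
    qed
    moreover have "?\<zeta> \<in> configs L N"
      using b j by (intro jump_in_configs[OF \<xi> _ yL False]) (auto simp: bij_betw_def)
    ultimately show ?thesis
      using False by (simp only: weighted_schur_enumeration if_False)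
  qed
qed

text \<open>
  The jumps onto occupied sites, which the graph excludes, contribute zero to the sum over all
  unit moves, so that sum is the adjacency sum, or twice the adjacency sum if \<open>L = 2\<close>, and
  \<open>weighted_schur_laplacian\<close> gives the eigenvalue.
\<close>

lemma weighted_schur_adj_eigen:
  assumes N: "1 \<le> N" "N \<le> L - 1"
  shows "\<exists>\<kappa>. \<forall>\<xi>\<in>configs L N.
     (\<Sum>\<zeta>\<in>configs L N. complex_of_real (adj L \<xi> \<zeta>) * weighted_schur N lam (roots_of L \<zeta>))
       = complex_of_real \<kappa> * weighted_schur N lam (roots_of L \<xi>)"
proof -
  \<comment> \<open>on a ring with two sites both unit moves of a particle give the same edge\<close>
  define m :: real where "m = (if L = 2 then 2 else 1)"
  define E where "E = (\<Sum>i<N. 2 * cos (pi * (2 * real (exponent N lam i) - real (N - 1)) / L))"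
  have L: "2 \<le> L" using N by simp
  have "(\<Sum>\<zeta>\<in>configs L N. complex_of_real (adj L \<xi> \<zeta>) * weighted_schur N lam (roots_of L \<zeta>))
       = complex_of_real (E / m) * weighted_schur N lam (roots_of L \<xi>)"
    if \<xi>: "\<xi> \<in> configs L N" for \<xi>
  proof -
    let ?h = "\<lambda>\<zeta>. weighted_schur N lam (roots_of L \<zeta>)"
    let ?x = "\<lambda>l. real (particle \<xi> l)"
    \<comment> \<open>extended by zero to jumps onto occupied sites\<close>
    define \<phi> where "\<phi> x y = (if y \<in> \<xi> then 0 else ?h (insert y (\<xi> - {x})))" for x y
    note b = bij_betw_particle[OF \<xi>]
    have xL: "particle \<xi> j < L" if "j < N" for j using that by (rule particle_less[OF \<xi>])
    have jumps: "complex_of_real m * (\<Sum>y\<in>ring_neighbours L x - \<xi>. ?h (insert y (\<xi> - {x})))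
        = \<phi> x ((x + 1) mod L) + \<phi> x ((x + L - 1) mod L)" if "x \<in> \<xi>" for x
    proof -
      have x: "x < L" using that config_subset[OF \<xi>] by auto
      have "(\<Sum>y\<in>ring_neighbours L x - \<xi>. ?h (insert y (\<xi> - {x}))) = (\<Sum>y\<in>ring_neighbours L x. \<phi> x y)"
        unfolding \<phi>_def by (intro sum.mono_neutral_cong_left) (auto simp: ring_neighbours_def)
      moreover have "(x + 1) mod L = (x + L - 1) mod L \<longleftrightarrow> L = 2"
        unfolding succ_mod[OF x] pred_mod[OF x] using x L by auto
      ultimately show ?thesis
        by (cases "L = 2") (simp_all add: ring_neighbours_def m_def)
    qed
    have right: "weighted_schur N lam (\<lambda>l. unity_root L ((?x(j := ?x j + 1)) l))
        = \<phi> (particle \<xi> j) ((particle \<xi> j + 1) mod L)" if j: "j < N" for j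
    proof -
      let ?y = "(particle \<xi> j + 1) mod L"
      have "unity_root L (real ?y) = unity_root L (?x j + 1)"
        using L unity_root_mod[of L "particle \<xi> j + 1"] by (simp add: add.commute)
      then have "weighted_schur N lam (\<lambda>l. unity_root L ((?x(j := ?x j + 1)) l))
          = weighted_schur N lam (\<lambda>l. unity_root L (real (if l = j then ?y else particle \<xi> l)))"
        by (intro weighted_schur_cong) auto
      also have "\<dots> = \<phi> (particle \<xi> j) ?y"
        unfolding \<phi>_def by (rule weighted_schur_jump[OF L \<xi> j]) (simp add: ring_neighbours_def)
      finally show ?thesis .
    qed
    have left: "weighted_schur N lam (\<lambda>l. unity_root L ((?x(j := ?x j - 1)) l))
        = \<phi> (particle \<xi> j) ((particle \<xi> j + L - 1) mod L)" if j: "j < N" for j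
    proof -
      let ?y = "(particle \<xi> j + L - 1) mod L"
      have "unity_root L (real ?y) = unity_root L (real (particle \<xi> j + L - 1))"
        using L by (intro unity_root_mod) simp
      also have "real (particle \<xi> j + L - 1) = (?x j - 1) + real L * real 1"
        using L by (simp add: of_nat_diff)
      also have "unity_root L \<dots> = unity_root L (?x j - 1)"
        using L by (intro unity_root_shift) simp
      finally have "weighted_schur N lam (\<lambda>l. unity_root L ((?x(j := ?x j - 1)) l))
          = weighted_schur N lam (\<lambda>l. unity_root L (real (if l = j then ?y else particle \<xi> l)))"
        by (intro weighted_schur_cong) auto
      also have "\<dots> = \<phi> (particle \<xi> j) ?y"
        unfolding \<phi>_def by (rule weighted_schur_jump[OF L \<xi> j]) (simp add: ring_neighbours_def)
      finally show ?thesis .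
    qed
    have "complex_of_real m * (\<Sum>\<zeta>\<in>configs L N. complex_of_real (adj L \<xi> \<zeta>) * ?h \<zeta>)
        = complex_of_real m * (\<Sum>x\<in>\<xi>. \<Sum>y\<in>ring_neighbours L x - \<xi>. ?h (insert y (\<xi> - {x})))"
      by (simp only: sum_adj_eq_sum_jumps[OF \<xi>])
    also have "\<dots> = (\<Sum>x\<in>\<xi>. complex_of_real m * (\<Sum>y\<in>ring_neighbours L x - \<xi>. ?h (insert y (\<xi> - {x}))))"
      by (rule sum_distrib_left)
    also have "\<dots> = (\<Sum>x\<in>\<xi>. \<phi> x ((x + 1) mod L) + \<phi> x ((x + L - 1) mod L))"
      by (rule sum.cong[OF refl]) (rule jumps)
    also have "\<dots> = (\<Sum>j<N. \<phi> (particle \<xi> j) ((particle \<xi> j + 1) mod L) + \<phi> (particle \<xi> j) ((particle \<xi> j + L - 1) mod L))"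
      by (rule sum.reindex_bij_betw[OF b, symmetric])
    also have "\<dots> = (\<Sum>j<N. weighted_schur N lam (\<lambda>l. unity_root L ((?x(j := ?x j + 1)) l))
              + weighted_schur N lam (\<lambda>l. unity_root L ((?x(j := ?x j - 1)) l)))"
      by (rule sum.cong[OF refl]) (simp only: left right lessThan_iff)
    also have "\<dots> = complex_of_real E * ?h \<xi>"
      unfolding E_def
    proof (rule weighted_schur_laplacian)
      fix j l assume jl: "j < l" "l < N"
      have "particle \<xi> j < particle \<xi> l" using jl by (rule particle_strict[OF \<xi>])
      moreover have "particle \<xi> l < L" using jl by (intro xL)
      ultimately show "1 \<le> ?x l - ?x j \<and> ?x l - ?x j \<le> real L - 1" by auto
    qed (use L in simp)
    finally show ?thesis
      by (simp add: m_def field_simps split: if_splits)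
  qed
  then show ?thesis by blast
qed

section \<open>Connectedness\<close>

lemma adjacent_left_jump:
  assumes \<eta>: "\<eta> \<in> configs L N" and x: "x \<in> \<eta>" "x \<noteq> 0" "x - 1 \<notin> \<eta>"
  shows "adjacent L \<eta> (insert (x - 1) (\<eta> - {x}))"
proof -
  have "x < L" using config_subset[OF \<eta>] x by auto
  then have "x - 1 < L" "x = (x - 1 + 1) mod L" using x by auto
  then show ?thesis unfolding adjacent_def using x by blast
qed

lemma adjacent_sym_imp:
  assumes "\<xi> \<in> configs L N" "adjacent L \<xi> \<eta>"
  shows "adjacent L \<eta> \<xi>"
proof -
  obtain x y where xy: "x \<in> \<xi>" "y < L" "y \<notin> \<xi>" "y = (x + 1) mod L \<or> x = (y + 1) mod L"
      "\<eta> = insert y (\<xi> - {x})"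
    using assms by (auto simp: adjacent_def)
  then have "x < L" "x \<notin> \<eta>" "y \<in> \<eta>" "\<xi> = insert x (\<eta> - {y})"
    using config_subset[OF assms(1)] by auto
  then show ?thesis using xy(4) unfolding adjacent_def by blast
qed

lemma downward_closed_config:
  assumes \<eta>: "\<eta> \<in> configs L N" and closed: "\<And>x. x \<in> \<eta> \<Longrightarrow> x \<noteq> 0 \<Longrightarrow> x - 1 \<in> \<eta>"
  shows "\<eta> = {..<N}"
proof -
  have "{..x} \<subseteq> \<eta>" if "x \<in> \<eta>" for x
    using that
  proof (induction x)
    case (Suc x)
    then have "x \<in> \<eta>" using closed[of "Suc x"] by simp
    then show ?case using Suc by (auto simp: atMost_Suc)
  qed auto
  then have "card {..x} \<le> card \<eta>" if "x \<in> \<eta>" for x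
    using that finite_config[OF \<eta>] by (intro card_mono) auto
  then have "\<eta> \<subseteq> {..<N}" using \<eta> by (fastforce simp: configs_def)
  then show ?thesis using \<eta> by (intro card_subset_eq) (auto simp: configs_def)
qed

text \<open>
  Every configuration is joined to \<open>{..<N}\<close>: as long as some particle has an empty site to its
  left, move it there, which decreases the sum of the positions.
\<close>

lemma adjacency_irreducible:
  assumes Z: "Z \<subseteq> configs L N" "Z \<noteq> {}"
    and closed: "\<And>\<xi> \<eta>. \<xi> \<in> Z \<Longrightarrow> \<eta> \<in> configs L N \<Longrightarrow> adjacent L \<xi> \<eta> \<Longrightarrow> \<eta> \<in> Z"
  shows "Z = configs L N"
proof -
  have same: "\<eta> \<in> Z \<longleftrightarrow> {..<N} \<in> Z" if "\<eta> \<in> configs L N" for \<eta>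
    using that
  proof (induction "\<Sum>\<eta>" arbitrary: \<eta> rule: less_induct)
    case less
    show ?case
    proof (cases "\<exists>x\<in>\<eta>. x \<noteq> 0 \<and> x - 1 \<notin> \<eta>")
      case False
      then show ?thesis using downward_closed_config[OF less.prems] by blast
    next
      case True
      then obtain x where x: "x \<in> \<eta>" "x \<noteq> 0" "x - 1 \<notin> \<eta>" by blast
      define \<zeta> where "\<zeta> = insert (x - 1) (\<eta> - {x})"
      have fin: "finite \<eta>" by (rule finite_config[OF less.prems])
      have "x < L" using config_subset[OF less.prems] x by auto
      then have \<zeta>: "\<zeta> \<in> configs L N"
        unfolding \<zeta>_def using x by (intro jump_in_configs[OF less.prems]) auto
      have adj: "adjacent L \<eta> \<zeta>"
        unfolding \<zeta>_def by (rule adjacent_left_jump[OF less.prems x])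
      have "\<Sum>\<zeta> = (x - 1) + \<Sum>(\<eta> - {x})" using x fin by (simp add: \<zeta>_def)
      moreover have "\<Sum>\<eta> = x + \<Sum>(\<eta> - {x})" using x fin by (simp add: sum.remove)
      ultimately have "\<Sum>\<zeta> < \<Sum>\<eta>" using x by linarith
      then have "\<zeta> \<in> Z \<longleftrightarrow> {..<N} \<in> Z" using less.hyps \<zeta> by blast
      moreover have "\<eta> \<in> Z \<longleftrightarrow> \<zeta> \<in> Z"
        using closed adj adjacent_sym_imp[OF less.prems adj] \<zeta> less.prems by blast
      ultimately show ?thesis by simp
    qed
  qed
  then show ?thesis using Z by blast
qed

section \<open>The ground state\<close>

text \<open>
  The uniqueness part of the Perron--Frobenius theorem for symmetric matrices. Symmetry forces
  the two eigenvalues to agree, since the eigenvectors are not orthogonal. Subtract from \<open>f\<close> the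
  largest multiple of \<open>g\<close> that keeps the difference nonnegative. The difference is an eigenvector
  that vanishes somewhere; at a zero, a sum of nonnegative terms vanishes, so all neighbours are
  zeros too, and by irreducibility the difference is zero.
\<close>

lemma positive_eigenvectors_proportional:
  fixes w :: "'a \<Rightarrow> 'a \<Rightarrow> real"
  assumes S: "finite S" "S \<noteq> {}"
    and sym: "\<And>x y. w x y = w y x" and nonneg: "\<And>x y. 0 \<le> w x y"
    and irreducible: "\<And>Z. Z \<subseteq> S \<Longrightarrow> Z \<noteq> {} \<Longrightarrow>
          (\<And>x y. x \<in> Z \<Longrightarrow> y \<in> S \<Longrightarrow> w x y \<noteq> 0 \<Longrightarrow> y \<in> Z) \<Longrightarrow> Z = S"
    and pos: "\<And>x. x \<in> S \<Longrightarrow> 0 < f x" "\<And>x. x \<in> S \<Longrightarrow> 0 < g x"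
    and f: "\<And>x. x \<in> S \<Longrightarrow> (\<Sum>y\<in>S. w x y * f y) = r * f x"
    and g: "\<And>x. x \<in> S \<Longrightarrow> (\<Sum>y\<in>S. w x y * g y) = k * g x"
  obtains t where "0 < t" "\<And>x. x \<in> S \<Longrightarrow> f x = t * g x"
proof -
  have "r * (\<Sum>x\<in>S. f x * g x) = (\<Sum>x\<in>S. (\<Sum>y\<in>S. w x y * f y) * g x)"
    by (simp add: f sum_distrib_left mult.assoc)
  also have "\<dots> = (\<Sum>x\<in>S. \<Sum>y\<in>S. w x y * f y * g x)"
    by (simp only: sum_distrib_right)
  also have "\<dots> = (\<Sum>y\<in>S. \<Sum>x\<in>S. w x y * f y * g x)"
    by (rule sum.swap)
  also have "\<dots> = (\<Sum>y\<in>S. f y * (\<Sum>x\<in>S. w y x * g x))"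
    unfolding sum_distrib_left by (intro sum.cong refl) (simp add: sym mult_ac)
  also have "\<dots> = (\<Sum>y\<in>S. f y * (k * g y))"
    by (simp add: g)
  also have "\<dots> = k * (\<Sum>x\<in>S. f x * g x)"
    by (simp add: sum_distrib_left mult.left_commute)
  finally have "r * (\<Sum>x\<in>S. f x * g x) = k * (\<Sum>x\<in>S. f x * g x)" .
  moreover have "0 < (\<Sum>x\<in>S. f x * g x)"
    using S pos by (intro sum_pos) auto
  ultimately have rk: "r = k" by simp
  \<comment> \<open>the largest multiple of \<open>g\<close> below \<open>f\<close>\<close>
  define t where "t = Min ((\<lambda>x. f x / g x) ` S)"
  have t_le: "t \<le> f x / g x" if "x \<in> S" for x
    unfolding t_def using S that by (intro Min_le) auto
  have "t \<in> (\<lambda>x. f x / g x) ` S"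
    unfolding t_def using S by (intro Min_in) auto
  then obtain x0 where x0: "x0 \<in> S" "t = f x0 / g x0" by auto
  define d where "d x = f x - t * g x" for x
  have d_nonneg: "0 \<le> d x" if "x \<in> S" for x
    using t_le[OF that] pos(2)[OF that] by (simp add: d_def field_simps)
  have d_eigen: "(\<Sum>y\<in>S. w x y * d y) = r * d x" if "x \<in> S" for x
  proof -
    have "(\<Sum>y\<in>S. w x y * d y) = (\<Sum>y\<in>S. w x y * f y) - t * (\<Sum>y\<in>S. w x y * g y)"
      by (simp add: d_def right_diff_distrib sum_subtractf sum_distrib_left mult_ac)
    also have "\<dots> = r * f x - t * (k * g x)" by (simp only: f[OF that] g[OF that])
    also have "\<dots> = r * d x" by (simp add: rk d_def algebra_simps)
    finally show ?thesis .
  qed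
  have "{x \<in> S. d x = 0} = S"
  proof (rule irreducible)
    have "d x0 = 0" using x0 pos(2)[OF x0(1)] by (simp add: d_def)
    then show "{x \<in> S. d x = 0} \<noteq> {}" using x0 by auto
  next
    fix x y assume x: "x \<in> {x \<in> S. d x = 0}" and y: "y \<in> S" "w x y \<noteq> 0"
    have "(\<Sum>y\<in>S. w x y * d y) = 0" using x d_eigen by simp
    then have "w x y * d y = 0"
      using S y nonneg d_nonneg by (subst (asm) sum_nonneg_eq_0_iff) auto
    then show "y \<in> {x \<in> S. d x = 0}" using y by simp
  qed auto
  then have "f x = t * g x" if "x \<in> S" for x using that by (auto simp: d_def)
  moreover have "0 < t" using x0 pos by simp
  ultimately show ?thesis by (rule that[rotated])
qed

lemma weighted_schur_config:
  "weighted_schur N lam (roots_of L \<eta>)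
     = complex_of_real (cmod (vandermonde N (roots_of L \<eta>))) * schur_config L N lam \<eta>"
  by (simp add: weighted_schur_def schur_config_eq)

lemma vandermonde_config_nonzero:
  assumes "\<eta> \<in> configs L N"
  shows "vandermonde N (roots_of L \<eta>) \<noteq> 0"
proof (cases "L = 0")
  case True
  then have "N = 0" using assms by (auto simp: configs_def)
  then show ?thesis by (simp add: vandermonde_eq_prod)
next
  case False
  then have "inj_on (\<lambda>k. unity_root L (real k)) (particle \<eta> ` {..<N})"
    using particle_less[OF assms] by (intro inj_on_subset[OF inj_on_unity_root]) auto
  then have "inj_on (roots_of L \<eta>) {..<N}"
    using bij_betw_particle[OF assms] comp_inj_on[of "particle \<eta>" "{..<N}" "\<lambda>k. unity_root L (real k)"]
    by (simp add: bij_betw_def comp_def)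
  then show ?thesis by (simp add: vandermonde_eq_0_iff)
qed

lemma empty_partition_in_box: "replicate N 0 \<in> partitions_in_box N M"
  by (auto simp: partitions_in_box_def sorted_wrt_iff_nth_less)

text \<open>
  The empty partition makes numerator and denominator equal, so \<open>\<bar>V\<bar>\<close> itself is one of the
  weighted Schur functions; it is the positive one.
\<close>

lemma schur_config_empty_partition:
  assumes "\<eta> \<in> configs L N"
  shows "schur_config L N (replicate N 0) \<eta> = 1"
proof -
  have "slater N (\<lambda>i t. t ^ exponent N (replicate N 0) i) (roots_of L \<eta>) = vandermonde N (roots_of L \<eta>)"
    unfolding vandermonde_def by (rule slater_cong) (simp add: exponent_def)
  then show ?thesis
    using vandermonde_config_nonzero[OF assms] by (simp add: schur_config_eq schur_eq_ratio)
qed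

text \<open>
  The orthogonality relation of the empty partition with itself.
\<close>

lemma sum_vandermonde_squared:
  assumes "N \<le> L"
  shows "(\<Sum>\<eta>\<in>configs L N. (cmod (vandermonde N (roots_of L \<eta>)))\<^sup>2) = real L ^ N"
proof -
  have "complex_of_real (\<Sum>\<eta>\<in>configs L N. (cmod (vandermonde N (roots_of L \<eta>)))\<^sup>2)
      = (\<Sum>\<eta>\<in>configs L N. schur_config L N (replicate N 0) \<eta> * cnj (schur_config L N (replicate N 0) \<eta>)
            * complex_of_real ((cmod (vandermonde N (roots_of L \<eta>)))\<^sup>2))"
    unfolding of_real_sum by (intro sum.cong refl) (simp add: schur_config_empty_partition)
  also have "\<dots> = complex_of_real (real L ^ N)"
    using schur_config_orthogonal[OF empty_partition_in_box empty_partition_in_box assms] by simp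
  finally show ?thesis by (simp only: of_real_eq_iff)
qed

text \<open>
  Both \<open>\<psi>\<close> and \<open>\<bar>V\<bar>\<close> are positive eigenvectors of the adjacency matrix, so they are
  proportional, and the normalisation of \<open>\<psi>\<close> fixes the factor.
\<close>

lemma ground_state:
  fixes \<psi> :: "nat set \<Rightarrow> real"
  assumes N: "1 \<le> N" "N \<le> L - 1"
    and psi_pos: "\<forall>\<eta>\<in>configs L N. \<psi> \<eta> > 0"
    and psi_eigen: "\<forall>\<xi>\<in>configs L N. (\<Sum>\<eta>\<in>configs L N. adj L \<xi> \<eta> * \<psi> \<eta>) = r * \<psi> \<xi>"
    and psi_norm: "(\<Sum>\<eta>\<in>configs L N. (\<psi> \<eta>)\<^sup>2) = 1"
  obtains t where "0 < t" "t\<^sup>2 * real L ^ N = 1"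
    "\<And>\<eta>. \<eta> \<in> configs L N \<Longrightarrow> \<psi> \<eta> = t * cmod (vandermonde N (roots_of L \<eta>))"
proof -
  let ?v = "\<lambda>\<eta>. cmod (vandermonde N (roots_of L \<eta>))"
  \<comment> \<open>cut off outside the configurations, where adjacency need not be symmetric\<close>
  let ?w = "\<lambda>\<xi> \<eta>. if \<xi> \<in> configs L N \<and> \<eta> \<in> configs L N then adj L \<xi> \<eta> else 0"
  obtain k where k: "\<And>\<xi>. \<xi> \<in> configs L N \<Longrightarrow>
     (\<Sum>\<zeta>\<in>configs L N. complex_of_real (adj L \<xi> \<zeta>) * weighted_schur N (replicate N 0) (roots_of L \<zeta>))
       = complex_of_real k * weighted_schur N (replicate N 0) (roots_of L \<xi>)"
    using weighted_schur_adj_eigen[OF N, of "replicate N 0"] by blast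
  have v_eigen: "(\<Sum>\<zeta>\<in>configs L N. adj L \<xi> \<zeta> * ?v \<zeta>) = k * ?v \<xi>" if "\<xi> \<in> configs L N" for \<xi>
  proof -
    have "complex_of_real (\<Sum>\<zeta>\<in>configs L N. adj L \<xi> \<zeta> * ?v \<zeta>) = complex_of_real (k * ?v \<xi>)"
      using k[OF that] that by (simp add: weighted_schur_config schur_config_empty_partition)
    then show ?thesis by (simp only: of_real_eq_iff)
  qed
  have nonempty: "configs L N \<noteq> {}"
  proof -
    have "{..<N} \<in> configs L N" using N by (auto simp: configs_def)
    then show ?thesis by blast
  qed
  obtain t where t: "0 < t" "\<And>\<eta>. \<eta> \<in> configs L N \<Longrightarrow> \<psi> \<eta> = t * ?v \<eta>"
  proof (rule positive_eigenvectors_proportional[of "configs L N" ?w \<psi> ?v r k])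
    show "?w x y = ?w y x" for x y
    proof (cases "x \<in> configs L N \<and> y \<in> configs L N")
      case True
      then have "adjacent L x y \<longleftrightarrow> adjacent L y x" using adjacent_sym_imp by blast
      then show ?thesis by (simp add: adj_def)
    qed auto
    show "0 \<le> ?w x y" for x y by (simp add: adj_def)
    show "Z = configs L N" if "Z \<subseteq> configs L N" "Z \<noteq> {}"
      "\<And>x y. x \<in> Z \<Longrightarrow> y \<in> configs L N \<Longrightarrow> ?w x y \<noteq> 0 \<Longrightarrow> y \<in> Z" for Z
      by (rule adjacency_irreducible[OF that(1,2)]) (use that in \<open>auto simp: adj_def\<close>)
    show "0 < ?v x" if "x \<in> configs L N" for x using vandermonde_config_nonzero[OF that] by simp
    show "(\<Sum>y\<in>configs L N. ?w x y * \<psi> y) = r * \<psi> x" if "x \<in> configs L N" for x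
      using psi_eigen that by simp
    show "(\<Sum>y\<in>configs L N. ?w x y * ?v y) = k * ?v x" if "x \<in> configs L N" for x
      using v_eigen that by simp
  qed (use psi_pos finite_configs nonempty in auto)
  have "1 = (\<Sum>\<eta>\<in>configs L N. t\<^sup>2 * (?v \<eta>)\<^sup>2)"
    unfolding psi_norm[symmetric] by (intro sum.cong refl) (simp add: t power_mult_distrib)
  also have "\<dots> = t\<^sup>2 * real L ^ N"
    using N by (simp add: sum_distrib_left[symmetric] sum_vandermonde_squared)
  finally show ?thesis using t that by simp
qed

section \<open>The orthonormal basis of eigenfunctions\<close>

theorem proposition2p4:
  fixes L N :: nat and \<psi> :: "nat set \<Rightarrow> real"
  assumes "1 \<le> N" and "N \<le> L - 1"
    and psi_pos: "\<forall>\<eta>\<in>configs L N. \<psi> \<eta> > 0"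
    and psi_eigen: "\<forall>\<xi>\<in>configs L N.
          (\<Sum>\<eta>\<in>configs L N. adj L \<xi> \<eta> * \<psi> \<eta>) = adj_radius L N * \<psi> \<xi>"
    and psi_norm: "(\<Sum>\<eta>\<in>configs L N. (\<psi> \<eta>)\<^sup>2) = 1"
  shows "l2_orthonormal_basis (configs L N) (\<lambda>\<eta>. (\<psi> \<eta>)\<^sup>2)
           (partitions_in_box N (L - N)) (schur_config L N) \<and>
         (\<forall>lam\<in>partitions_in_box N (L - N).
           eigenfunction_on (configs L N) (messep_kernel L N \<psi>) (schur_config L N lam))"
proof -
  let ?C = "configs L N" and ?P = "partitions_in_box N (L - N)" and ?s = "schur_config L N"
  let ?v = "\<lambda>\<eta>. cmod (vandermonde N (roots_of L \<eta>))"
  have NL: "N \<le> L" using assms(2) by simp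
  obtain t where t: "0 < t" "t\<^sup>2 * real L ^ N = 1" and psi: "\<And>\<eta>. \<eta> \<in> ?C \<Longrightarrow> \<psi> \<eta> = t * ?v \<eta>"
    using ground_state[OF assms(1,2) psi_pos psi_eigen psi_norm] by blast
  have inner: "l2_inner ?C (\<lambda>\<eta>. (\<psi> \<eta>)\<^sup>2) (?s lam) (?s mu) = (if lam = mu then 1 else 0)"
    if "lam \<in> ?P" "mu \<in> ?P" for lam mu
  proof -
    have "l2_inner ?C (\<lambda>\<eta>. (\<psi> \<eta>)\<^sup>2) (?s lam) (?s mu)
        = (\<Sum>\<eta>\<in>?C. complex_of_real (t\<^sup>2) * (?s lam \<eta> * cnj (?s mu \<eta>) * complex_of_real ((?v \<eta>)\<^sup>2)))"
      unfolding l2_inner_def by (intro sum.cong refl) (simp add: psi power_mult_distrib mult_ac)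
    also have "\<dots> = complex_of_real (t\<^sup>2) * (if lam = mu then of_nat L ^ N else 0)"
      by (simp only: sum_distrib_left[symmetric] schur_config_orthogonal[OF that NL])
    also have "\<dots> = complex_of_real (if lam = mu then t\<^sup>2 * real L ^ N else 0)"
      by simp
    finally show ?thesis using t by simp
  qed
  have bij: "bij_betw (\<lambda>lam. exponent N lam ` {..<N}) ?P ?C"
    by (rule bij_betw_partitions_configs[OF NL])
  have basis: "l2_orthonormal_basis ?C (\<lambda>\<eta>. (\<psi> \<eta>)\<^sup>2) ?P ?s"
    by (rule orthonormal_family_spans)
       (use inner bij bij_betw_finite[OF bij] finite_configs[of L N] in \<open>auto dest: bij_betw_same_card\<close>)
  have "eigenfunction_on ?C (messep_kernel L N \<psi>) (?s lam)" if lam: "lam \<in> ?P" for lam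
  proof -
    obtain \<kappa> where \<kappa>: "\<And>\<xi>. \<xi> \<in> ?C \<Longrightarrow>
       (\<Sum>\<zeta>\<in>?C. complex_of_real (adj L \<xi> \<zeta>) * (complex_of_real (?v \<zeta>) * ?s lam \<zeta>))
         = complex_of_real \<kappa> * (complex_of_real (?v \<xi>) * ?s lam \<xi>)"
      using weighted_schur_adj_eigen[OF assms(1,2), of lam] unfolding weighted_schur_config by blast
    have "(\<Sum>\<zeta>\<in>?C. complex_of_real (messep_kernel L N \<psi> \<xi> \<zeta>) * ?s lam \<zeta>)
        = complex_of_real (\<kappa> / adj_radius L N) * ?s lam \<xi>" if \<xi>: "\<xi> \<in> ?C" for \<xi>
    proof -
      have v: "?v \<xi> \<noteq> 0" using vandermonde_config_nonzero[OF \<xi>] by simp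
      \<comment> \<open>the factor \<open>t\<close> cancels in the kernel\<close>
      let ?c = "complex_of_real (1 / (adj_radius L N * ?v \<xi>))"
      have "(\<Sum>\<zeta>\<in>?C. complex_of_real (messep_kernel L N \<psi> \<xi> \<zeta>) * ?s lam \<zeta>)
          = (\<Sum>\<zeta>\<in>?C. ?c * (complex_of_real (adj L \<xi> \<zeta>) * (complex_of_real (?v \<zeta>) * ?s lam \<zeta>)))"
      proof (rule sum.cong[OF refl])
        fix \<zeta> assume "\<zeta> \<in> ?C"
        then have "messep_kernel L N \<psi> \<xi> \<zeta> = 1 / (adj_radius L N * ?v \<xi>) * adj L \<xi> \<zeta> * ?v \<zeta>"
          using t(1) by (simp add: messep_kernel_def psi \<xi>)
        then show "complex_of_real (messep_kernel L N \<psi> \<xi> \<zeta>) * ?s lam \<zeta>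
            = ?c * (complex_of_real (adj L \<xi> \<zeta>) * (complex_of_real (?v \<zeta>) * ?s lam \<zeta>))"
          by (simp only: of_real_mult mult.assoc)
      qed
      also have "\<dots> = ?c * (complex_of_real \<kappa> * (complex_of_real (?v \<xi>) * ?s lam \<xi>))"
        by (simp only: sum_distrib_left[symmetric] \<kappa>[OF \<xi>])
      also have "\<dots> = complex_of_real (\<kappa> / adj_radius L N) * ?s lam \<xi>"
        using v by (simp add: field_simps)
      finally show ?thesis .
    qed
    moreover have "\<exists>x\<in>?C. ?s lam x \<noteq> 0"
    proof (rule ccontr)
      assume "\<not> (\<exists>x\<in>?C. ?s lam x \<noteq> 0)"
      then have "l2_inner ?C (\<lambda>\<eta>. (\<psi> \<eta>)\<^sup>2) (?s lam) (?s lam) = 0"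
        by (simp add: l2_inner_def)
      then show False using inner[OF lam lam] by simp
    qed
    ultimately show ?thesis unfolding eigenfunction_on_def by blast
  qed
  then show ?thesis using basis by blast
qed

end
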